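(* Let $\{\xi_i\}_{i\ge0}$ be any sequence of i.i.d. complex random variables such that $$\mathbb{E}\log(1+|\xi_0|)=\infty\qquad\text{and}\qquad \mathbb{P}(|\xi_0|>e^{t})=o(t^{-1})\ \text{ as } t\to+\infty,$$ and let $\{q_n\}_{n\ge0}$ be any sequence of orthonormal polynomials constructed with respect to a finite measure $\tau$ on the unit circle $\{|z|=1\}$ satisfying the Bernstein-Markov property on $\{|z|=1\}$. For $n\ge1$ let $H_n(z)=\sum_{i=0}^n\xi_iq_i(z)$. Then $Z_{H_n}\to\frac{1}{2\pi}d\theta$ in probability in the weak* topology, and hence any subsequence $\{Z_{H_{n_i}}\}$ has a further subsequence which converges weak* almost surely to $\frac1{2\pi}d\theta$.
   Context: $\frac{1}{2\pi}d\theta$ is the uniform probability measure on the unit circle. The measure $\tau$ on $K=\{|z|=1\}$ satisfies the Bernstein-Markov property if for every $\epsilon>0$ there is $M>0$ such that for all $n$ and all polynomials $p$ of degree at most $n$, $\sup_K|p|\le Me^{\epsilon n}\|p\|_{L^2(\tau)}$. The $q_n$ are obtained by applying Gram-Schmidt to $1,z,z^2,\dots$ in $L^2(\tau)$. $Z_{H_n}=\frac1n\sum_j\delta_{z_j}$, the sum being over the zeros of $H_n$ counted with multiplicity (set to be the zero measure on the event $H_n\equiv0$). It is a positive measure of total mass at most $1$; the weak* topology is that of testing against bounded continuous functions on $\mathbb{C}$. Convergence in probability of $Z_{H_n}$ to $\mu$ means $\mathbb{P}(Z_{H_n}\in U)\to1$ for every weak* open set $U$ containing $\mu$. *)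

theory Defs
  imports "HOL-Probability.Probability"
    "HOL-Computational_Algebra.Fundamental_Theorem_Algebra"
    "HOL-Library.Landau_Symbols"
begin

section \<open>Orthonormal polynomials and the Bernstein-Markov property\<close>

definition L2_inner :: "complex measure \<Rightarrow> complex poly \<Rightarrow> complex poly \<Rightarrow> complex" where
  "L2_inner \<tau> p q = (\<integral>z. poly p z * cnj (poly q z) \<partial>\<tau>)"

definition L2_norm :: "complex measure \<Rightarrow> complex poly \<Rightarrow> real" where
  "L2_norm \<tau> p = sqrt (\<integral>z. (cmod (poly p z))\<^sup>2 \<partial>\<tau>)"

text \<open>
  A measure on the circle \<open>K\<close> is represented as a Borel measure on the plane that does not
  charge the complement of \<open>K\<close>.
\<close>

definition finite_measure_on :: "complex set \<Rightarrow> complex measure \<Rightarrow> bool" where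
  "finite_measure_on K \<tau> \<longleftrightarrow>
     finite_measure \<tau> \<and> sets \<tau> = sets borel \<and> emeasure \<tau> (- K) = 0"

definition bernstein_markov :: "complex set \<Rightarrow> complex measure \<Rightarrow> bool" where
  "bernstein_markov K \<tau> \<longleftrightarrow>
     (\<forall>\<epsilon>>0. \<exists>M>0. \<forall>n. \<forall>p :: complex poly. degree p \<le> n \<longrightarrow>
        (SUP z\<in>K. cmod (poly p z)) \<le> M * exp (\<epsilon> * real n) * L2_norm \<tau> p)"

text \<open>
  The Gram-Schmidt recursion applied to \<open>1, z, z\<^sup>2, \<dots>\<close>; \<open>r\<close> is \<open>z\<^sup>n\<close> minus its projection onto
  the span of \<open>q 0, \<dots>, q (n - 1)\<close>. If \<open>\<tau>\<close> satisfies the Bernstein-Markov property on the circle,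
  every such \<open>r\<close> has positive norm, so the normalisation is a genuine one.
\<close>

definition gram_schmidt_monomials :: "complex measure \<Rightarrow> (nat \<Rightarrow> complex poly) \<Rightarrow> bool" where
  "gram_schmidt_monomials \<tau> q \<longleftrightarrow>
     (\<forall>n. let r = monom 1 n - (\<Sum>k<n. smult (L2_inner \<tau> (monom 1 n) (q k)) (q k))
          in q n = smult (1 / of_real (L2_norm \<tau> r)) r)"

definition random_poly ::
    "(nat \<Rightarrow> 'a \<Rightarrow> complex) \<Rightarrow> (nat \<Rightarrow> complex poly) \<Rightarrow> nat \<Rightarrow> 'a \<Rightarrow> complex poly" where
  "random_poly \<xi> q n \<omega> = (\<Sum>i\<le>n. smult (\<xi> i \<omega>) (q i))"


section \<open>Normalised zero measures\<close>

text \<open>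
  The normalisation is by \<open>n\<close>, not by the number of zeros. The library sets
  \<open>proots 0 = {#}\<close>, so the zero polynomial gets the zero measure.
\<close>

definition zero_counting :: "nat \<Rightarrow> complex poly \<Rightarrow> complex measure" where
  "zero_counting n p =
     measure_of UNIV (sets borel)
       (\<lambda>A. ennreal (1 / real n) * (\<Sum>z\<in>#proots p. emeasure (return borel z) A))"

lemma sets_zero_counting [simp, measurable_cong]: "sets (zero_counting n p) = sets borel"
  unfolding zero_counting_def
  using sets.sets_measure_of_eq [of "borel :: complex measure"] by simp

lemma space_zero_counting [simp]: "space (zero_counting n p) = UNIV"
  by (simp add: zero_counting_def)

lemma emeasure_zero_counting:
  assumes "A \<in> sets borel"
  shows "emeasure (zero_counting n p) A =
           ennreal (1 / real n) * (\<Sum>z\<in>#proots p. emeasure (return borel z) A)"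
proof -
  have "countably_additive (sets borel) (\<lambda>A. \<Sum>z\<in>#N. emeasure (return borel z) A)"
    for N :: "complex multiset"
  proof (induction N)
    case empty
    then show ?case by (simp add: countably_additive_def)
  next
    case (add x N)
    show ?case
    proof (rule countably_additiveI)
      fix A :: "nat \<Rightarrow> complex set"
      assume A: "range A \<subseteq> sets borel" "disjoint_family A" "(\<Union>i. A i) \<in> sets borel"
      have 1: "(\<Sum>i. emeasure (return borel x) (A i)) = emeasure (return borel x) (\<Union>i. A i)"
        using A by (intro suminf_emeasure) auto
      have 2: "(\<Sum>i. \<Sum>z\<in>#N. emeasure (return borel z) (A i)) =
                 (\<Sum>z\<in>#N. emeasure (return borel z) (\<Union>i. A i))"
        using add A by (auto simp: countably_additive_def)
      show "(\<Sum>i. \<Sum>z\<in>#add_mset x N. emeasure (return borel z) (A i)) =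
              (\<Sum>z\<in>#add_mset x N. emeasure (return borel z) (\<Union>i. A i))"
        unfolding image_mset_add_mset sum_mset.add_mset 1 [symmetric] 2 [symmetric]
        by (rule suminf_add [symmetric]) simp_all
    qed
  qed
  then have "countably_additive (sets borel)
      (\<lambda>A. ennreal (1 / real n) * (\<Sum>z\<in>#proots p. emeasure (return borel z) A))"
    by (simp add: countably_additive_def)
  moreover have "sigma_algebra UNIV (sets borel :: complex set set)"
    using sets.sigma_algebra_axioms [of "borel :: complex measure"] by simp
  ultimately show ?thesis
    using assms unfolding zero_counting_def
    by (intro emeasure_measure_of_sigma) (auto simp: positive_def)
qed

definition uniform_circle :: "complex measure" where
  "uniform_circle = distr (uniform_measure lborel {0..2 * pi}) borel cis"


section \<open>Weak* topology and convergence in probability\<close>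

text \<open>
  The coarsest topology on the positive Borel measures of total mass at most 1 that makes
  \<open>\<mu> \<mapsto> \<integral> f d\<mu>\<close> continuous for every bounded continuous \<open>f\<close>.
\<close>

definition weak_star :: "complex measure topology" where
  "weak_star = topology_generated_by
     {{\<mu> \<in> space (subprob_algebra borel). (\<integral>z. f z \<partial>\<mu>) \<in> V} | (f :: complex \<Rightarrow> real) V.
        continuous_on UNIV f \<and> bounded (range f) \<and> open V}"

lemma topspace_weak_star: "topspace weak_star = space (subprob_algebra borel)"
proof -
  have "space (subprob_algebra borel) \<in>
     {{\<mu> \<in> space (subprob_algebra borel). (\<integral>z. f z \<partial>\<mu>) \<in> V} | (f :: complex \<Rightarrow> real) V.
        continuous_on UNIV f \<and> bounded (range f) \<and> open V}"
    by (rule CollectI, rule exI [of _ "\<lambda>_. 0"], rule exI [of _ UNIV]) auto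
  then show ?thesis
    unfolding weak_star_def topology_generated_by_topspace by blast
qed

lemma uniform_circle_in_topspace: "uniform_circle \<in> topspace weak_star"
proof -
  have "prob_space (uniform_measure lborel {0..2 * pi})"
    by (rule prob_space_uniform_measure) auto
  moreover have "cis \<in> borel_measurable borel"
    by (intro borel_measurable_continuous_onI continuous_intros)
  ultimately have "prob_space uniform_circle"
    unfolding uniform_circle_def by (intro prob_space.prob_space_distr) auto
  then show ?thesis
    by (simp add: topspace_weak_star space_subprob_algebra prob_space_imp_subprob_space
        uniform_circle_def)
qed

lemma zero_counting_in_topspace:
  assumes "degree p \<le> n"
  shows "zero_counting n p \<in> topspace weak_star"
proof -
  have "(\<Sum>z\<in>#N. emeasure (return borel z) UNIV) = of_nat (size N)" for N :: "complex multiset"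
    by (induction N) auto
  then have "emeasure (zero_counting n p) UNIV = ennreal (1 / real n) * of_nat (degree p)"
    by (simp add: emeasure_zero_counting size_proots_complex)
  also have "\<dots> = ennreal (real (degree p) / real n)"
    by (simp add: ennreal_of_nat_eq_real_of_nat flip: ennreal_mult)
  also have "\<dots> \<le> 1"
    using assms by (cases "n = 0") (simp_all add: divide_le_eq_1)
  finally have "subprob_space (zero_counting n p)"
    by (intro subprob_spaceI) auto
  then show ?thesis
    by (simp add: topspace_weak_star space_subprob_algebra)
qed

definition converges_in_probability ::
    "'a measure \<Rightarrow> 'b topology \<Rightarrow> (nat \<Rightarrow> 'a \<Rightarrow> 'b) \<Rightarrow> 'b \<Rightarrow> bool" where
  "converges_in_probability M T Z \<mu> \<longleftrightarrow>
     (\<forall>U. openin T U \<and> \<mu> \<in> U \<longrightarrow> (\<lambda>n. measure M {\<omega> \<in> space M. Z n \<omega> \<in> U}) \<longlonglongrightarrow> 1)"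

end

theory Submission
  imports Defs "HOL-Complex_Analysis.Complex_Analysis"
begin

text \<open>
  Write \<open>w \<mapsto> w / max 1 \<bar>w\<bar>\<^sup>2\<close> for the map that fixes the closed unit disc and reflects its exterior
  into it. On the circle \<open>\<bar>p z\<bar>\<close> is the Mahler measure of \<open>p\<close> times \<open>\<Prod> \<bar>1 - w' z\<bar>\<close>, where \<open>w'\<close> runs
  through the conjugates of the folded roots. If \<open>p\<close> is at most \<open>exp (\<epsilon> n)\<close> on the circle and one
  coefficient of index at most \<open>\<epsilon> n\<close>, as well as one of index at least \<open>(1 - \<epsilon>) n\<close>, is not
  exponentially small, then, since coefficients are dominated by the Mahler measure times a
  binomial coefficient, the Mahler measure lies between \<open>exp (- \<epsilon> n)\<close> and \<open>exp (\<epsilon> n)\<close> and only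
  \<open>O(\<epsilon> n)\<close> roots stay away from the circle. The product is then at most \<open>exp (2 \<epsilon> n)\<close>, and the
  Schwarz lemma applied to its logarithm bounds every power sum of the folded roots by \<open>O(\<epsilon> n)\<close>.
  Weierstrass approximation gives equidistribution.

  The upper bound holds with high probability because of the tail condition on \<open>\<xi>\<close> and the
  Bernstein-Markov property. For the lower bounds, if the last (or first) \<open>J + 1\<close> coefficients of
  \<open>H n\<close> are all tiny, then back-substitution confines \<open>J + 1\<close> of the independent \<open>\<xi> i\<close> to unit discs
  (in the second case centred at functions of the remaining \<open>\<xi> i\<close>); since \<open>\<xi> 0\<close> is unbounded, this
  has probability at most \<open>\<rho> ^ (J + 1)\<close> for some \<open>\<rho> < 1\<close>.
\<close>

section \<open>Roots, coefficients and Mahler measure\<close>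

definition mahler :: "complex poly \<Rightarrow> real" where
  "mahler p = cmod (lead_coeff p) * (\<Prod>\<zeta>\<in>#proots p. max 1 (cmod \<zeta>))"

definition fold_disc :: "complex \<Rightarrow> complex" where
  "fold_disc z = z / of_real ((max 1 (cmod z))\<^sup>2)"

section \<open>Reflected roots, coefficient bounds and root counts\<close>

lemma prod_mset_image_nonneg: "(\<And>x. x \<in># N \<Longrightarrow> f x \<ge> (0::real)) \<Longrightarrow> (\<Prod>x\<in>#N. f x) \<ge> 0"
  by (induction N) auto

lemma continuous_on_fold_disc: "continuous_on S fold_disc"
  unfolding fold_disc_def by (intro continuous_intros) (auto simp: max_def)

lemma fold_disc_circle [simp]: "cmod z = 1 \<Longrightarrow> fold_disc z = z"
  by (simp add: fold_disc_def)

lemma norm_fold_disc: "cmod (fold_disc z) \<le> 1"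
proof -
  have "cmod z \<le> (max 1 (cmod z))\<^sup>2"
    using mult_mono[of 1 "max 1 (cmod z)" "cmod z" "max 1 (cmod z)"]
    by (simp add: power2_eq_square)
  moreover have "max 1 (cmod z) > 0" by simp
  ultimately show ?thesis
    by (simp add: fold_disc_def norm_divide norm_power divide_le_eq)
qed

text \<open>Outside the disc \<open>cnj (fold_disc a)\<close> is \<open>1 / a\<close>, so factoring
  out \<open>a\<close> suffices; inside, \<open>a\<close> is fixed and \<open>z * cnj z = 1\<close>
  turns \<open>z - a\<close> into \<open>z\<close> times a conjugate. Either way the remaining
  factor has no zero in the open disc.\<close>

lemma norm_diff_circle:
  assumes "cmod z = 1"
  shows "cmod (z - a) = max 1 (cmod a) * cmod (1 - cnj (fold_disc a) * z)"
proof (cases "cmod a \<ge> 1")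
  case True
  then have a: "a \<noteq> 0" by auto
  have "cnj (fold_disc a) = 1 / a"
    using True a complex_norm_square[of a] by (simp add: fold_disc_def max_def field_simps)
  then have "a * (1 - cnj (fold_disc a) * z) = a - z"
    using a by (simp add: algebra_simps)
  then have "cmod a * cmod (1 - cnj (fold_disc a) * z) = cmod (a - z)"
    by (metis norm_mult)
  then show ?thesis using True by (simp add: max_def norm_minus_commute)
next
  case False
  have "z * cnj z = 1" using assms complex_norm_square[of z] by simp
  then have "z - a = z * cnj (1 - cnj a * z)"
    by (simp add: algebra_simps)
  then have "cmod (z - a) = cmod (1 - cnj a * z)"
    using assms by (metis complex_mod_cnj mult_1 norm_mult)
  then show ?thesis using False by (simp add: max_def fold_disc_def)
qed

lemma norm_prod_mset: "norm (\<Prod>x\<in>#N. f x) = (\<Prod>x\<in>#N. norm (f x))"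
  for f :: "'a \<Rightarrow> 'b::{real_normed_field}"
  by (induction N) (auto simp: norm_mult)

lemma poly_eq_prod_proots:
  "poly p z = lead_coeff p * (\<Prod>a\<in>#proots p. z - a)" for p :: "complex poly"
proof -
  have "poly p z = poly (smult (lead_coeff p) (\<Prod>x\<in>#proots p. [:-x, 1:])) z"
    by (simp only: complex_poly_decompose_multiset)
  also have "\<dots> = lead_coeff p * (\<Prod>a\<in>#proots p. z - a)"
    by (simp add: poly_prod_mset image_mset.compositionality o_def)
  finally show ?thesis .
qed

text \<open>On the circle \<open>p\<close> has the modulus of a constant times a polynomial that is
  1 at the origin and zero-free in the open disc, which opens the way to the maximum principle and
  to a holomorphic logarithm.\<close>

lemma norm_poly_circle:
  assumes "cmod z = 1"
  shows "cmod (poly p z) = mahler p * (\<Prod>w\<in>#image_mset (cnj \<circ> fold_disc) (proots p). cmod (1 - w * z))"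
proof -
  have "cmod (poly p z) = cmod (lead_coeff p) * (\<Prod>a\<in>#proots p. cmod (z - a))"
    by (simp add: poly_eq_prod_proots[of p] norm_mult norm_prod_mset)
  also have "\<dots> = cmod (lead_coeff p) * (\<Prod>a\<in>#proots p. max 1 (cmod a) * cmod (1 - cnj (fold_disc a) * z))"
    using norm_diff_circle[OF assms] by simp
  also have "\<dots> = mahler p * (\<Prod>a\<in>#proots p. cmod (1 - cnj (fold_disc a) * z))"
    by (simp add: mahler_def prod_mset.distrib mult.assoc)
  finally show ?thesis by (simp add: image_mset.compositionality o_def)
qed

text \<open>Up to sign, the coefficient is a sum over the choices of \<open>size N - i\<close>
  roots; times \<open>t ^ i\<close>, each of these products is at most the product on the right. The
  induction step is Pascal's rule. The free weight \<open>t\<close> serves to count roots: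
  \<open>t < 1\<close> detects small ones, \<open>t > 1\<close> large ones.\<close>

lemma coeff_prod_linear_le:
  fixes N :: "complex multiset"
  assumes "t \<ge> 0"
  shows "t ^ i * cmod (coeff (\<Prod>x\<in>#N. [:-x, 1:]) i)
           \<le> real (size N choose i) * (\<Prod>x\<in>#N. max t (cmod x))"
proof (induction N arbitrary: i)
  case empty
  then show ?case by (cases i) (auto simp: coeff_1)
next
  case (add a N)
  define c where "c = coeff (\<Prod>x\<in>#N. [:-x, 1:])"
  define B where "B = (\<Prod>x\<in>#N. max t (cmod x))"
  have B: "B \<ge> 0" unfolding B_def using assms by (intro prod_mset_image_nonneg) (auto simp: max_def)
  have IH: "t ^ i * cmod (c i) \<le> real (size N choose i) * B" for i
    using add[of i] by (simp add: c_def B_def)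
  show ?case
  proof (cases i)
    case 0
    have "cmod a * cmod (c 0) \<le> max t (cmod a) * B"
      using IH[of 0] by (intro mult_mono) (auto simp: le_max_iff_disj)
    then show ?thesis using 0 by (simp add: c_def B_def norm_mult)
  next
    case (Suc k)
    have "t ^ i * cmod (coeff (\<Prod>x\<in>#add_mset a N. [:-x, 1:]) i) = t ^ i * cmod (c k - a * c i)"
      using Suc by (simp add: c_def)
    also have "\<dots> \<le> t ^ i * (cmod (c k) + cmod a * cmod (c i))"
      using norm_triangle_ineq4[of "c k" "a * c i"] assms
      by (intro mult_left_mono) (auto simp: norm_mult)
    also have "\<dots> = t * (t ^ k * cmod (c k)) + cmod a * (t ^ i * cmod (c i))"
      using Suc by (simp add: algebra_simps)
    also have "\<dots> \<le> max t (cmod a) * (real (size N choose k) * B) + max t (cmod a) * (real (size N choose i) * B)"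
      using IH B assms by (intro add_mono mult_mono[OF _ IH] mult_mono[OF max.cobounded1 IH]) (auto simp: le_max_iff_disj)
    also have "\<dots> = real (size (add_mset a N) choose i) * (\<Prod>x\<in>#add_mset a N. max t (cmod x))"
      using Suc by (simp add: B_def algebra_simps)
    finally show ?thesis .
  qed
qed

lemma coeff_le_prod_proots:
  assumes "t \<ge> 0"
  shows "t ^ i * cmod (coeff p i)
    \<le> real (degree p choose i) * (cmod (lead_coeff p) * (\<Prod>x\<in>#proots p. max t (cmod x)))"
proof -
  have "coeff p i = lead_coeff p * coeff (\<Prod>x\<in>#proots p. [:-x, 1:]) i"
    by (metis coeff_smult complex_poly_decompose_multiset)
  then have "t ^ i * cmod (coeff p i) = cmod (lead_coeff p) * (t ^ i * cmod (coeff (\<Prod>x\<in>#proots p. [:-x, 1:]) i))"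
    by (simp add: norm_mult)
  also have "\<dots> \<le> cmod (lead_coeff p) * (real (degree p choose i) * (\<Prod>x\<in>#proots p. max t (cmod x)))"
    using coeff_prod_linear_le[OF assms, of i "proots p"]
    by (intro mult_left_mono) (auto simp: size_proots_complex)
  finally show ?thesis by (simp add: algebra_simps)
qed

lemma mahler_nonneg: "mahler p \<ge> 0"
  unfolding mahler_def by (intro mult_nonneg_nonneg prod_mset_image_nonneg) auto

text \<open>Each root in the disc of radius \<open>r\<close> saves a factor \<open>r\<close> against
  the product in the Mahler measure. Hence many small roots force the low coefficients to be
  tiny.\<close>

lemma prod_max_small:
  assumes "0 < r" "r \<le> 1"
  shows "(\<Prod>x\<in>#N. max r (cmod x)) \<le> r ^ size {#x \<in># N. cmod x \<le> r#} * (\<Prod>x\<in>#N. max 1 (cmod x))"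
proof (induction N)
  case (add a N)
  have "(\<Prod>x\<in>#N. max r (cmod x)) \<ge> 0" using assms by (intro prod_mset_image_nonneg) (auto simp: max_def)
  moreover have "max r (cmod a) \<le> (if cmod a \<le> r then r else 1) * max 1 (cmod a)"
    using assms by (auto simp: max_def)
  ultimately have "max r (cmod a) * (\<Prod>x\<in>#N. max r (cmod x)) \<le>
    ((if cmod a \<le> r then r else 1) * max 1 (cmod a)) *
    (r ^ size {#x \<in># N. cmod x \<le> r#} * (\<Prod>x\<in>#N. max 1 (cmod x)))"
    using add assms by (intro mult_mono) (auto simp: max_def)
  then show ?case by (simp add: algebra_simps split: if_splits)
qed auto

text \<open>Always \<open>max R \<bar>x\<bar> \<le> R * max 1 \<bar>x\<bar>\<close>, with a factor
  \<open>R\<close> to spare when \<open>\<bar>x\<bar> \<ge> R\<close>.\<close>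

lemma prod_max_large:
  assumes "R \<ge> 1"
  shows "R ^ size {#x \<in># N. cmod x \<ge> R#} * (\<Prod>x\<in>#N. max R (cmod x)) \<le> R ^ size N * (\<Prod>x\<in>#N. max 1 (cmod x))"
proof (induction N)
  case (add a N)
  have "(\<Prod>x\<in>#N. max R (cmod x)) \<ge> 0" using assms by (intro prod_mset_image_nonneg) (auto simp: max_def)
  moreover have "(if cmod a \<ge> R then R else 1) * max R (cmod a) \<le> R * max 1 (cmod a)"
    using assms by (auto simp: max_def mult_left_mono)
  ultimately have "((if cmod a \<ge> R then R else 1) * max R (cmod a)) *
     (R ^ size {#x \<in># N. cmod x \<ge> R#} * (\<Prod>x\<in>#N. max R (cmod x))) \<le>
    (R * max 1 (cmod a)) * (R ^ size N * (\<Prod>x\<in>#N. max 1 (cmod x)))"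
    using add assms by (intro mult_mono[where d = "R ^ size N * (\<Prod>x\<in>#N. max 1 (cmod x))"] mult_nonneg_nonneg) (auto simp: le_max_iff_disj)
  then show ?case by (simp add: algebra_simps split: if_splits)
qed auto

text \<open>This is the factorisation of \<open>X ^ k - 1\<close> at \<open>1 / x\<close>,
  multiplied by \<open>x ^ k\<close>. It serves to pass from a bound on a product over
  \<open>w\<close> to one over the powers \<open>w ^ k\<close>.\<close>

lemma prod_one_minus_roots_unity:
  fixes x :: complex
  assumes "k > 0"
  shows "(\<Prod>u | u ^ k = 1. 1 - u * x) = 1 - x ^ k"
proof (cases "x = 0")
  case True
  then show ?thesis using assms by simp
next
  case False
  define p :: "complex poly" where "p = monom 1 k - 1"
  have poly_p: "poly p z = z ^ k - 1" for z by (simp add: p_def poly_monom)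
  \<comment> \<open>The derivative of \<open>X ^ k - 1\<close> can vanish only at 0, which is not a
    root.\<close>
  have "rsquarefree p"
    unfolding rsquarefree_roots
  proof (intro allI notI, elim conjE)
    fix a assume "poly p a = 0" "poly (pderiv p) a = 0"
    then have "a ^ k = 1" "of_nat k * a ^ (k - 1) = 0"
      by (simp_all add: poly_p) (simp add: p_def pderiv_diff pderiv_monom poly_monom)
    then have "a = 0" using assms by simp
    then show False using \<open>a ^ k = 1\<close> assms by (simp add: power_0_left)
  qed
  have "degree p = k"
    using assms unfolding p_def diff_conv_add_uminus
    by (subst degree_add_eq_left) (auto simp: degree_monom_eq)
  then have lc: "lead_coeff p = 1" using assms by (simp add: p_def)
  have "poly p (1 / x) = poly (smult (lead_coeff p) (\<Prod>u | poly p u = 0. [:- u, 1:])) (1 / x)"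
    using complex_poly_decompose_rsquarefree[OF \<open>rsquarefree p\<close>] by simp
  also have "\<dots> = (\<Prod>u | poly p u = 0. (1 / x) - u)"
    by (simp add: lc poly_prod)
  finally have *: "(\<Prod>u | u ^ k = 1. (1 / x) - u) = (1 / x) ^ k - 1"
    by (simp add: poly_p)
  have "(\<Prod>u | u ^ k = 1. 1 - u * x) = (\<Prod>u\<in>{u. u ^ k = 1}. x * (1 / x - u))"
    using False by (intro prod.cong) (simp_all add: right_diff_distrib mult.commute)
  also have "\<dots> = x ^ k * ((1 / x) ^ k - 1)"
    using * assms by (simp add: prod.distrib card_roots_unity_eq)
  also have "\<dots> = 1 - x ^ k"
    using False by (simp add: right_diff_distrib flip: power_mult_distrib)
  finally show ?thesis .
qed

lemma poly_max_modulus: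
  assumes "\<And>z. cmod z = 1 \<Longrightarrow> cmod (poly p z) \<le> B" "cmod z \<le> 1"
  shows "cmod (poly p z) \<le> B"
proof (rule maximum_modulus_frontier[where S = "cball 0 1" and f = "poly p"])
  show "poly p holomorphic_on interior (cball 0 1)"
    by (intro holomorphic_intros)
  show "continuous_on (closure (cball 0 1)) (poly p)"
    by (intro continuous_intros)
qed (use assms in auto)

section \<open>The Schwarz lemma for the logarithm of a zero-free product\<close>

lemma exp_sum_Ln: 
  assumes "\<And>w. w \<in># V \<Longrightarrow> f w \<noteq> 0"
  shows "exp (\<Sum>w\<in>#V. Ln (f w)) = (\<Prod>w\<in>#V. f w)"
  using assms
proof (induction V)
  case (add x V)
  then have "exp (Ln (f x)) = f x" "exp (\<Sum>w\<in>#V. Ln (f w)) = (\<Prod>w\<in>#V. f w)" by auto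
  then show ?case unfolding image_mset_add_mset sum_mset.add_mset prod_mset.add_mset exp_add by simp
qed simp

lemma one_minus_mult_not_nonpos: assumes "cmod w \<le> 1" "cmod z < 1"
 shows "1 - w * z \<notin> \<real>\<^sub>\<le>\<^sub>0"
proof -
    have "cmod (w * z) < 1"
      using mult_left_le_one_le[of "cmod z" "cmod w"] assms by (simp add: norm_mult)
    then have "Re (1 - w * z) > 0"
      using complex_Re_le_cmod[of "w * z"] by (simp del: times_complex.sel)
    then show ?thesis by (simp add: complex_nonpos_Reals_iff)
qed

text \<open>
  The Schwarz lemma for \<open>h / (2 A - h)\<close>, where \<open>h = \<Sum>w. Ln (1 - w z)\<close> has real part less than \<open>A\<close>
  and \<open>h' 0 = - \<Sum>w. w\<close>.
\<close>
lemma sum_le_of_prod_le: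
  fixes W :: "complex multiset"
  assumes W: "\<And>w. w \<in># W \<Longrightarrow> cmod w \<le> 1" and A: "A > 0" "B < A"
    and le: "\<And>z. cmod z = 1 \<Longrightarrow> (\<Prod>w\<in>#W. cmod (1 - w * z)) \<le> exp B"
  shows "cmod (\<Sum>w\<in>#W. w) \<le> 2 * A"
proof -
  define h where "h = (\<lambda>z. \<Sum>w\<in>#W. Ln (1 - w * z))"
  define p where "p = (\<Prod>w\<in>#W. [:1, - w:])"
  have poly_p: "poly p z = (\<Prod>w\<in>#W. 1 - w * z)" for z
    by (simp add: p_def poly_prod_mset image_mset.compositionality o_def mult.commute)
  have ple: "cmod (poly p z) \<le> exp B" if "cmod z \<le> 1" for z
  proof (rule poly_max_modulus[OF _ that])
    fix z :: complex assume "cmod z = 1"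
    then show "cmod (poly p z) \<le> exp B" using le[of z] by (simp only: poly_p norm_prod_mset)
  qed
  have ne: "1 - w * z \<notin> \<real>\<^sub>\<le>\<^sub>0" if "w \<in># W" "cmod z < 1" for w z
    using one_minus_mult_not_nonpos[OF W] that by blast
  \<comment> \<open>Every \<open>1 - w * z\<close> has positive real part and so avoids the branch
    cut; the sum of the principal logarithms is thus a holomorphic logarithm of
    \<open>poly p\<close> in the open disc.\<close>
  have exph: "exp (h z) = poly p z" if "cmod z < 1" for z
    unfolding h_def poly_p by (rule exp_sum_Ln) (use ne[OF _ that] in force)
  have Reh: "Re (h z) < A" if "cmod z < 1" for z
  proof -
    have "exp (Re (h z)) \<le> exp B" using ple[of z] that by (metis exph less_imp_le norm_exp_eq_Re)
    then show ?thesis using A by simp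
  qed
  have der: "((\<lambda>z. \<Sum>w\<in>#V. Ln (1 - w * z)) has_field_derivative (\<Sum>w\<in>#V. - w / (1 - w * z))) (at z)"
    if "\<And>w. w \<in># V \<Longrightarrow> 1 - w * z \<notin> \<real>\<^sub>\<le>\<^sub>0" for V z
    using that
  proof (induction V)
    case (add v V)
    have "((\<lambda>z. 1 - v * z) has_field_derivative - v) (at z)"
      by (auto intro!: derivative_eq_intros)
    then have "((\<lambda>z. Ln (1 - v * z)) has_field_derivative inverse (1 - v * z) * - v) (at z)"
      using add.prems[of v] by (intro DERIV_chain2[OF has_field_derivative_Ln]) simp_all
    then have "((\<lambda>z. Ln (1 - v * z)) has_field_derivative - v / (1 - v * z)) (at z)"
      by (simp add: field_class.field_divide_inverse mult.commute)
    moreover have "((\<lambda>z. \<Sum>w\<in>#V. Ln (1 - w * z)) has_field_derivative (\<Sum>w\<in>#V. - w / (1 - w * z))) (at z)"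
      using add by simp
    ultimately show ?case
      unfolding image_mset_add_mset sum_mset.add_mset by (rule DERIV_add)
  qed auto
  have derh: "(h has_field_derivative (\<Sum>w\<in>#W. - w / (1 - w * z))) (at z)" if "cmod z < 1" for z
    unfolding h_def by (rule der) (rule ne[OF _ that])
  have nz: "2 * of_real A - h z \<noteq> 0" if "cmod z < 1" for z
  proof -
    have "Re (2 * of_real A - h z) > 0" using Reh[OF that] A by simp
    then show ?thesis by (metis less_irrefl zero_complex.sel(1))
  qed
  define g where "g = (\<lambda>z. h z / (2 * of_real A - h z))"
  have h0: "h 0 = 0" by (simp add: h_def)
  have dg: "(g has_field_derivative ((\<Sum>w\<in>#W. - w / (1 - w * z)) * (2 * of_real A - h z)
      - h z * (0 - (\<Sum>w\<in>#W. - w / (1 - w * z)))) / ((2 * of_real A - h z) * (2 * of_real A - h z))) (at z)"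
    if "cmod z < 1" for z
    unfolding g_def by (intro DERIV_divide DERIV_diff DERIV_const derh nz that)
  have "g holomorphic_on ball 0 1"
    unfolding holomorphic_on_open[OF open_ball]
  proof
    fix z :: complex assume "z \<in> ball 0 1"
    then have "cmod z < 1" by simp
    from dg[OF this] show "\<exists>g'. (g has_field_derivative g') (at z)" by (rule exI)
  qed
  moreover have "g 0 = 0" by (simp add: g_def h0)
  moreover have "cmod (g z) < 1" if z: "cmod z < 1" for z
  proof -
    \<comment> \<open>A point is closer to 0 than to \<open>2 * A\<close> exactly when its real part
      is below \<open>A\<close>, so the quotient maps that half-plane into the open unit
      disc.\<close>
    have "(cmod (h z))\<^sup>2 < (cmod (2 * of_real A - h z))\<^sup>2"
      using Reh[OF z] A unfolding cmod_power2
      by (simp add: power2_eq_square algebra_simps)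
    then show ?thesis using nz[OF z]
      by (simp add: g_def norm_divide divide_less_eq_1 power2_less_imp_less)
  qed
  ultimately have "cmod (deriv g 0) \<le> 1"
    using Schwarz_Lemma(2)[of g 0] by auto
  \<comment> \<open>Since \<open>h 0 = 0\<close>, the derivative of the quotient at 0 is
    \<open>h' 0 / (2 * A)\<close>.\<close>
  moreover have "deriv g 0 = - (\<Sum>w\<in>#W. w) / (2 * of_real A)"
  proof -
    have "(\<Sum>w\<in>#V. - w / (1 - w * 0)) = - (\<Sum>w\<in>#V. w)" for V :: "complex multiset"
      by (induction V) auto
    then show ?thesis using DERIV_imp_deriv[OF dg[of 0]] A by (simp add: h0)
  qed
  ultimately show ?thesis using A by (simp add: norm_divide divide_le_eq)
qed

lemma integral_zero_counting:
  assumes f: "f \<in> borel_measurable borel"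
  shows "(\<integral>z. f z \<partial>zero_counting n p) = (\<Sum>z\<in>#proots p. f z :: real) / real n"
proof -
  obtain xs where xs: "proots p = mset xs" by (metis ex_mset)
  have sum_xs: "(\<Sum>z\<in>#mset xs. g z) = (\<Sum>i<length xs. g (xs ! i))"
    for g :: "complex \<Rightarrow> 'b::comm_monoid_add"
    by (simp add: sum_mset_sum_list sum_list_sum_nth atLeast0LessThan flip: mset_map)
  \<comment> \<open>Indexing by positions in a list separates repeated roots, so the zero measure
    becomes the image of a point measure on a finite set.\<close>
  define P where "P = point_measure {..<length xs} (\<lambda>_. ennreal (1 / real n))"
  have nth: "(!) xs \<in> measurable P borel" by (simp add: P_def)
  have "zero_counting n p = distr P borel ((!) xs)"
  proof (rule measure_eqI)
    fix A assume "A \<in> sets (zero_counting n p)"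
    then have A: "A \<in> sets borel" by simp
    have sp: "space P = {..<length xs}" by (simp add: P_def space_point_measure)
    have "emeasure (distr P borel ((!) xs)) A = emeasure P ((!) xs -` A \<inter> {..<length xs})"
      using A nth by (simp add: emeasure_distr sp)
    also have "\<dots> = (\<Sum>i\<in>(!) xs -` A \<inter> {..<length xs}. ennreal (1 / real n))"
      unfolding P_def by (rule emeasure_point_measure_finite) auto
    also have "\<dots> = (\<Sum>i<length xs. ennreal (1 / real n) * indicator A (xs ! i))"
      by (rule sum.mono_neutral_cong_left) (auto simp: indicator_def)
    also have "\<dots> = ennreal (1 / real n) * (\<Sum>z\<in>#proots p. emeasure (return borel z) A)"
      using A by (simp add: xs sum_xs sum_distrib_left)
    finally show "emeasure (zero_counting n p) A = emeasure (distr P borel ((!) xs)) A"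
      using A by (simp add: emeasure_zero_counting)
  qed simp
  then have "(\<integral>z. f z \<partial>zero_counting n p) = (\<integral>i. f (xs ! i) \<partial>P)"
    using f nth by (simp add: integral_distr)
  also have "\<dots> = (\<Sum>i<length xs. f (xs ! i)) / real n"
    unfolding P_def by (subst lebesgue_integral_point_measure_finite) (auto simp: sum_divide_distrib)
  also have "(\<Sum>i<length xs. f (xs ! i)) = (\<Sum>z\<in>#proots p. f z)"
    by (simp add: xs sum_xs)
  finally show ?thesis .
qed

text \<open>Dividing by the Mahler measure leaves, on the circle, the modulus of a polynomial with
  value 1 at the origin; the maximum principle bounds this 1 by \<open>B / mahler p\<close>.\<close>

lemma mahler_le:
  assumes "\<And>z. cmod z = 1 \<Longrightarrow> cmod (poly p z) \<le> B"
  shows "mahler p \<le> B"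
proof (cases "mahler p = 0")
  case True
  then show ?thesis using assms[of 1] by (simp add: order_trans[OF norm_ge_zero])
next
  case False
  define W where "W = image_mset (cnj \<circ> fold_disc) (proots p)"
  define F where "F = (\<Prod>w\<in>#W. [:1, - w:])"
  have F: "poly F z = (\<Prod>w\<in>#W. 1 - w * z)" for z
    by (simp add: F_def poly_prod_mset image_mset.compositionality o_def mult.commute)
  have m: "mahler p > 0" using False mahler_nonneg[of p] by simp
  have "cmod (poly F 0) \<le> B / mahler p"
  proof (rule poly_max_modulus)
    fix z :: complex assume z: "cmod z = 1"
    show "cmod (poly F z) \<le> B / mahler p"
      using assms[OF z] m unfolding norm_poly_circle[OF z] W_def[symmetric] F norm_prod_mset
      by (simp add: field_simps)
  qed simp
  moreover have "poly F 0 = 1" by (simp add: F)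
  ultimately show ?thesis using m by (simp add: field_simps)
qed

text \<open>The binomial factor is the one that \<open>coeff_le_prod_proots\<close> loses.\<close>

definition good :: "nat \<Rightarrow> real \<Rightarrow> complex poly \<Rightarrow> bool" where
  "good n \<epsilon> p \<longleftrightarrow> degree p \<le> n \<and>
     (\<forall>z. cmod z = 1 \<longrightarrow> cmod (poly p z) \<le> exp (\<epsilon> * real n)) \<and>
     (\<exists>j\<le>n. real j \<le> \<epsilon> * real n \<and>
        real (n choose j) * exp (- \<epsilon> * real n) \<le> cmod (coeff p j)) \<and>
     (\<exists>j\<le>n. real j \<le> \<epsilon> * real n \<and>
        real (n choose j) * exp (- \<epsilon> * real n) \<le> cmod (coeff p (n - j)))"

section \<open>Distribution of the roots of a good polynomial\<close>

context
  fixes n :: nat and \<epsilon> :: real and p :: "complex poly"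
  assumes good: "good n \<epsilon> p" and n: "n \<ge> 1" and eps: "\<epsilon> > 0"
begin

lemma good_degree: "degree p \<le> n"
  and good_circle: "cmod z = 1 \<Longrightarrow> cmod (poly p z) \<le> exp (\<epsilon> * real n)"
  using good by (auto simp: good_def)

lemma good_lowE: obtains j where "j \<le> n" "real j \<le> \<epsilon> * real n"
    "real (n choose j) * exp (- \<epsilon> * real n) \<le> cmod (coeff p j)"
  using good by (auto simp: good_def)

lemma good_highE: obtains j where "j \<le> n" "real j \<le> \<epsilon> * real n"
    "real (n choose j) * exp (- \<epsilon> * real n) \<le> cmod (coeff p (n - j))"
  using good by (auto simp: good_def)

lemma good_mahler_le: "mahler p \<le> exp (\<epsilon> * real n)"
  using good_circle by (rule mahler_le)

text \<open>The factor \<open>n choose i\<close> in the hypothesis cancels the one from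
  \<open>coeff_le_prod_proots\<close>, since \<open>degree p \<le> n\<close>.\<close>

lemma good_coeff_bound:
  assumes i: "i \<le> n" and c: "real (n choose i) * exp (- \<epsilon> * real n) \<le> cmod (coeff p i)"
    and t: "t \<ge> 0"
  shows "t ^ i * exp (- \<epsilon> * real n) \<le> cmod (lead_coeff p) * (\<Prod>x\<in>#proots p. max t (cmod x))"
proof -
  have nn: "(\<Prod>x\<in>#proots p. max t (cmod x)) \<ge> 0"
    using t by (intro prod_mset_image_nonneg) (auto simp: le_max_iff_disj)
  have "real (n choose i) * (t ^ i * exp (- \<epsilon> * real n)) \<le> t ^ i * cmod (coeff p i)"
    using mult_left_mono[OF c, of "t ^ i"] t by (simp add: mult_ac)
  also have "\<dots> \<le> real (degree p choose i) * (cmod (lead_coeff p) * (\<Prod>x\<in>#proots p. max t (cmod x)))"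
    by (rule coeff_le_prod_proots[OF t])
  also have "\<dots> \<le> real (n choose i) * (cmod (lead_coeff p) * (\<Prod>x\<in>#proots p. max t (cmod x)))"
    using good_degree nn by (intro mult_right_mono) (auto simp: binomial_right_mono)
  finally show ?thesis using i by (subst (asm) mult_le_cancel_left_pos) auto
qed

text \<open>At \<open>t = 1\<close> the right-hand side of \<open>good_coeff_bound\<close> is the
  Mahler measure.\<close>

lemma good_mahler_ge: "exp (- \<epsilon> * real n) \<le> mahler p"
proof (rule good_lowE)
  fix j assume "j \<le> n" "real (n choose j) * exp (- \<epsilon> * real n) \<le> cmod (coeff p j)"
  from good_coeff_bound[OF this, of 1] show ?thesis by (simp add: mahler_def)
qed

lemma good_degree_ge: "real n - real (degree p) \<le> \<epsilon> * real n"
proof (rule good_highE)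
  fix j assume j: "j \<le> n" "real j \<le> \<epsilon> * real n"
    "real (n choose j) * exp (- \<epsilon> * real n) \<le> cmod (coeff p (n - j))"
  have "real (n choose j) * exp (- \<epsilon> * real n) > 0" using j(1) by simp
  with j(3) have "coeff p (n - j) \<noteq> 0" by auto
  then have "n - j \<le> degree p" by (rule le_degree)
  then show ?thesis using j(1,2) by linarith
qed

text \<open>The coefficient bound at \<open>t = r\<close> and the upper bound on the Mahler measure
  give \<open>r ^ j * exp (- \<epsilon> * n) \<le> r ^ N * exp (\<epsilon> * n)\<close> for the
  number \<open>N\<close> of small roots. In the constant, 1 comes from
  \<open>j \<le> \<epsilon> * n\<close> and \<open>2 / ln (1 / r)\<close> from the two
  exponentials.\<close>

lemma good_small_roots:
  assumes r: "0 < r" "r < 1"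
  shows "real (size {#x \<in># proots p. cmod x \<le> r#}) \<le> \<epsilon> * real n * (1 + 2 / ln (1 / r))"
proof (rule good_lowE)
  fix j assume j: "j \<le> n" "real j \<le> \<epsilon> * real n"
    "real (n choose j) * exp (- \<epsilon> * real n) \<le> cmod (coeff p j)"
  define N where "N = size {#x \<in># proots p. cmod x \<le> r#}"
  have L: "ln (1 / r) > 0" using r by simp
  have "r ^ j * exp (- \<epsilon> * real n) \<le> cmod (lead_coeff p) * (\<Prod>x\<in>#proots p. max r (cmod x))"
    using j r by (intro good_coeff_bound) auto
  also have "\<dots> \<le> cmod (lead_coeff p) * (r ^ N * (\<Prod>x\<in>#proots p. max 1 (cmod x)))"
    unfolding N_def using r by (intro mult_left_mono prod_max_small) auto
  also have "\<dots> = r ^ N * mahler p" by (simp add: mahler_def)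
  also have "\<dots> \<le> r ^ N * exp (\<epsilon> * real n)" using good_mahler_le r by (intro mult_left_mono) auto
  finally have "ln (r ^ j * exp (- \<epsilon> * real n)) \<le> ln (r ^ N * exp (\<epsilon> * real n))"
    using r by simp
  then have "real j * ln r - \<epsilon> * real n \<le> real N * ln r + \<epsilon> * real n"
    using r by (simp add: ln_mult ln_realpow)
  then have "real N * ln (1 / r) \<le> real j * ln (1 / r) + 2 * (\<epsilon> * real n)"
    using r by (simp add: ln_div)
  then have "real N \<le> real j + 2 * (\<epsilon> * real n) / ln (1 / r)"
    using L by (simp add: field_simps)
  then show ?thesis using j(2) unfolding N_def by (simp add: algebra_simps)
qed

text \<open>The mirror image, from a coefficient near the top: up to the same two exponentials,
  \<open>R ^ N * R ^ (n - j) \<le> R ^ n\<close>, so \<open>N\<close> can exceed \<open>j\<close> by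
  only \<open>2 * \<epsilon> * n / ln R\<close>.\<close>

lemma good_large_roots:
  assumes R: "R > 1"
  shows "real (size {#x \<in># proots p. cmod x \<ge> R#}) \<le> \<epsilon> * real n * (1 + 2 / ln R)"
proof (rule good_highE)
  fix j assume j: "j \<le> n" "real j \<le> \<epsilon> * real n"
    "real (n choose j) * exp (- \<epsilon> * real n) \<le> cmod (coeff p (n - j))"
  define N where "N = size {#x \<in># proots p. cmod x \<ge> R#}"
  have L: "ln R > 0" using R by simp
  have "R ^ N * (R ^ (n - j) * exp (- \<epsilon> * real n))
    \<le> R ^ N * (cmod (lead_coeff p) * (\<Prod>x\<in>#proots p. max R (cmod x)))"
    using j R by (intro mult_left_mono good_coeff_bound) (auto simp flip: binomial_symmetric)
  also have "\<dots> \<le> cmod (lead_coeff p) * (R ^ size (proots p) * (\<Prod>x\<in>#proots p. max 1 (cmod x)))"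
    unfolding N_def using mult_left_mono[OF prod_max_large[of R "proots p"], of "cmod (lead_coeff p)"] R
    by (simp add: mult_ac)
  also have "\<dots> = R ^ degree p * mahler p" by (simp add: mahler_def size_proots_complex)
  also have "\<dots> \<le> R ^ n * exp (\<epsilon> * real n)"
    using good_mahler_le R good_degree by (intro mult_mono power_increasing) (auto simp: mahler_nonneg)
  finally have "ln (R ^ N * (R ^ (n - j) * exp (- \<epsilon> * real n))) \<le> ln (R ^ n * exp (\<epsilon> * real n))"
    using R by simp
  then have "real N * ln R + (real n - real j) * ln R - \<epsilon> * real n \<le> real n * ln R + \<epsilon> * real n"
    using R j(1) by (simp add: ln_mult ln_realpow of_nat_diff)
  then have "real N \<le> real j + 2 * (\<epsilon> * real n) / ln R"
    using L by (simp add: field_simps)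
  then show ?thesis using j(2) unfolding N_def by (simp add: algebra_simps)
qed

text \<open>Dividing the circle bound by the lower bound on the Mahler measure gives at most
  \<open>exp (2 * \<epsilon> * n)\<close> for the product over the reflected roots. For
  \<open>k\<close>-th powers the exponent is multiplied by \<open>k\<close>, and the Schwarz lemma
  turns it into a bound on the sum.\<close>

lemma good_power_sums:
  assumes k: "k \<ge> 1"
  shows "cmod (\<Sum>x\<in>#proots p. fold_disc x ^ k) \<le> 6 * real k * (\<epsilon> * real n)"
proof -
  define W where "W = image_mset (cnj \<circ> fold_disc) (proots p)"
  define V where "V = image_mset (\<lambda>w. w ^ k) W"
  have m: "mahler p > 0" using good_mahler_ge by (metis exp_gt_zero less_le_trans)
  have W: "(\<Prod>w\<in>#W. cmod (1 - w * z)) \<le> exp (2 * (\<epsilon> * real n))" if z: "cmod z = 1" for z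
  proof -
    have pos: "(\<Prod>w\<in>#W. cmod (1 - w * z)) \<ge> 0" by (intro prod_mset_image_nonneg) auto
    have "exp (- \<epsilon> * real n) * (\<Prod>w\<in>#W. cmod (1 - w * z)) \<le> mahler p * (\<Prod>w\<in>#W. cmod (1 - w * z))"
      using good_mahler_ge pos by (rule mult_right_mono)
    also have "\<dots> \<le> exp (\<epsilon> * real n)"
      using good_circle[OF z] unfolding norm_poly_circle[OF z] W_def[symmetric] .
    finally show ?thesis
      by (simp add: exp_minus field_simps flip: exp_add)
  qed
  \<comment> \<open>\<open>sum_le_of_prod_le\<close> wants \<open>A\<close> strictly above the
    exponent \<open>2 * k * \<epsilon> * n\<close>; taking \<open>3 * k * \<epsilon> * n\<close>
    gives the constant 6.\<close>
  have "cmod (\<Sum>w\<in>#V. w) \<le> 2 * (3 * real k * (\<epsilon> * real n))"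
  proof (rule sum_le_of_prod_le)
    fix w assume "w \<in># V"
    then show "cmod w \<le> 1"
      using norm_fold_disc by (auto simp: V_def W_def norm_power power_le_one)
  next
    show "3 * real k * (\<epsilon> * real n) > 0" "2 * real k * (\<epsilon> * real n) < 3 * real k * (\<epsilon> * real n)"
      using k n eps by auto
  next
    fix y :: complex assume y: "cmod y = 1"
    define U where "U = {u :: complex. u ^ k = 1}"
    have U: "finite U" "card U = k"
      using k by (auto simp: U_def finite_roots_unity card_roots_unity_eq)
    obtain z where z: "z ^ k = y"
      using k exists_complex_root[of k y] by auto
    have unit: "cmod x = 1" if "cmod x ^ k = 1" for x :: complex
      using that k power_eq_iff_eq_base[of k "cmod x" 1] by simp
    have nz: "cmod z = 1" using z y by (intro unit) (simp flip: norm_power)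
    have U1: "cmod u = 1" if "u \<in> U" for u
      using that by (intro unit) (simp add: U_def flip: norm_power)
    have ex: "(\<Prod>x\<in>#X. \<Prod>u\<in>U. g x u) = (\<Prod>u\<in>U. \<Prod>x\<in>#X. g x u)" for X :: "complex multiset" and g :: "complex \<Rightarrow> complex \<Rightarrow> real"
      by (induction X) (auto simp: prod.distrib)
    \<comment> \<open>multiplying the bound for \<open>W\<close> over all \<open>k\<close>-th roots of \<open>y\<close> gives the bound for the powers\<close>
    have "(\<Prod>w\<in>#V. cmod (1 - w * y)) = (\<Prod>w\<in>#W. cmod (1 - (w * z) ^ k))"
      by (simp add: V_def image_mset.compositionality o_def power_mult_distrib z)
    also have "\<dots> = (\<Prod>w\<in>#W. \<Prod>u\<in>U. cmod (1 - w * (u * z)))"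
    proof -
      have "1 - (w * z) ^ k = (\<Prod>u\<in>U. 1 - w * (u * z))" for w
        using prod_one_minus_roots_unity[of k "w * z"] k by (simp add: U_def mult.left_commute)
      then show ?thesis by (simp only: prod_norm)
    qed
    also have "\<dots> = (\<Prod>u\<in>U. \<Prod>w\<in>#W. cmod (1 - w * (u * z)))" by (rule ex)
    also have "\<dots> \<le> (\<Prod>u\<in>U. exp (2 * (\<epsilon> * real n)))"
      using nz U1 by (intro prod_mono conjI W prod_mset_image_nonneg) (auto simp: norm_mult)
    also have "\<dots> = exp (2 * real k * (\<epsilon> * real n))"
      using U by (simp flip: exp_of_nat_mult add: mult_ac)
    finally show "(\<Prod>w\<in>#V. cmod (1 - w * y)) \<le> exp (2 * real k * (\<epsilon> * real n))" .
  qed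
  moreover have "(\<Sum>w\<in>#V. w) = cnj (\<Sum>x\<in>#proots p. fold_disc x ^ k)"
  proof -
    have "(\<Sum>w\<in>#image_mset (\<lambda>w. w ^ k) (image_mset (cnj \<circ> fold_disc) X). w)
        = cnj (\<Sum>x\<in>#X. fold_disc x ^ k)" for X
      by (induction X) auto
    then show ?thesis unfolding V_def W_def .
  qed
  ultimately show ?thesis by simp
qed

end

section \<open>Approximation on the circle\<close>

text \<open>On the circle \<open>cnj z\<close> is \<open>1 / z\<close>, so the product is a Laurent
  polynomial, and conjugating its negative powers does not change the real part. The induction
  strips the constant terms of both factors and uses \<open>z * cnj z = 1\<close> on the
  rest.\<close>

lemma Re_mult_cnj_poly_circle:
  "\<exists>C. \<forall>z. cmod z = 1 \<longrightarrow> Re (poly A z * cnj (poly B z)) = Re (poly C z)"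
proof (induction A arbitrary: B)
  case 0
  then show ?case by (intro exI[of _ 0]) simp
next
  case (pCons a A)
  obtain b B' where B: "B = pCons b B'" by (metis pCons_cases)
  obtain C where C: "\<And>z. cmod z = 1 \<Longrightarrow> Re (poly A z * cnj (poly B' z)) = Re (poly C z)"
    using pCons.IH by blast
  have "Re (poly (pCons a A) z * cnj (poly B z)) =
      Re (poly (smult (cnj a) B + smult (cnj b) (pCons 0 A) + C) z)" if z: "cmod z = 1" for z
  proof -
    have zz: "z * cnj z = 1" using complex_norm_square[of z] z by simp
    have "poly (pCons a A) z * cnj (poly B z) =
      a * cnj (poly B z) + cnj b * (z * poly A z) + (z * cnj z) * (poly A z * cnj (poly B' z))"
      by (simp add: B algebra_simps)
    moreover have "Re (a * cnj (poly B z)) = Re (cnj a * poly B z)" by simp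
    ultimately show ?thesis unfolding zz using C[OF z] by (simp add: algebra_simps)
  qed
  then show ?case by blast
qed

text \<open>Products are the only delicate case: \<open>Re S * Re T\<close> is half the real part of
  \<open>S * T + S * cnj T\<close>. With test functions of the form \<open>Re (poly T z)\<close>
  only power sums with nonnegative exponents have to be estimated.\<close>

lemma real_polynomial_function_circle:
  fixes g :: "complex \<Rightarrow> real"
  assumes "real_polynomial_function g"
  shows "\<exists>T. \<forall>z. cmod z = 1 \<longrightarrow> g z = Re (poly T z)"
  using assms
proof induction
  case (linear f)
  \<comment> \<open>A real-linear \<open>f\<close> takes \<open>x + \<i> * y\<close> to
    \<open>x * f 1 + y * f \<i>\<close>, which is the real part of
    \<open>(f 1 - \<i> * f \<i>) * (x + \<i> * y)\<close>.\<close>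
  have "f z = Re (poly [:0, of_real (f 1) - \<i> * of_real (f \<i>):] z)" for z
  proof -
    have "z = Re z *\<^sub>R 1 + Im z *\<^sub>R \<i>" by (simp add: complex_eq_iff)
    then have "f z = f (Re z *\<^sub>R 1 + Im z *\<^sub>R \<i>)" by simp
    also have "\<dots> = Re z * f 1 + Im z * f \<i>"
      using linear by (simp add: bounded_linear_def linear_add linear_scale)
    finally show ?thesis by simp
  qed
  then show ?case by blast
next
  case (const c)
  show ?case by (rule exI[of _ "[:of_real c:]"]) simp
next
  case (add f g)
  then obtain S T where "\<And>z. cmod z = 1 \<Longrightarrow> f z = Re (poly S z)" "\<And>z. cmod z = 1 \<Longrightarrow> g z = Re (poly T z)"
    by blast
  then show ?case by (intro exI[of _ "S + T"]) simp
next
  case (mult f g)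
  then obtain S T where ST: "\<And>z. cmod z = 1 \<Longrightarrow> f z = Re (poly S z)" "\<And>z. cmod z = 1 \<Longrightarrow> g z = Re (poly T z)"
    by blast
  obtain C where C: "\<And>z. cmod z = 1 \<Longrightarrow> Re (poly S z * cnj (poly T z)) = Re (poly C z)"
    using Re_mult_cnj_poly_circle by blast
  have "f z * g z = Re (poly (smult (1/2) (S * T + C)) z)" if "cmod z = 1" for z
    using C[OF that] by (simp add: ST[OF that] field_simps)
  then show ?case by blast
qed

lemma approx_circle:
  fixes f :: "complex \<Rightarrow> real"
  assumes "continuous_on (sphere 0 1) f" "e > 0"
  obtains T where "\<And>z. cmod z = 1 \<Longrightarrow> \<bar>f z - Re (poly T z)\<bar> < e"
proof -
  obtain g where g: "real_polynomial_function g" "\<And>z. z \<in> sphere 0 1 \<Longrightarrow> \<bar>f z - g z\<bar> < e"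
    using Stone_Weierstrass_real_polynomial_function[OF compact_sphere assms] by blast
  then show ?thesis using real_polynomial_function_circle[OF g(1)] that by (metis dist_0_norm mem_sphere)
qed

section \<open>Integration against the uniform measure on the circle\<close>

abbreviation uniform_angle :: "real measure" where
  "uniform_angle \<equiv> uniform_measure lborel {0..2 * pi}"

lemma prob_space_uniform_angle: "prob_space uniform_angle"
  by (rule prob_space_uniform_measure) auto

lemma cis_measurable [measurable]: "cis \<in> borel_measurable borel"
  by (intro borel_measurable_continuous_onI continuous_intros)

lemma integral_uniform_circle:
  fixes f :: "complex \<Rightarrow> 'b::{banach, second_countable_topology}"
  assumes "f \<in> borel_measurable borel"
  shows "(\<integral>z. f z \<partial>uniform_circle) = (\<integral>\<theta>. f (cis \<theta>) \<partial>uniform_angle)"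
  unfolding uniform_circle_def using assms by (intro integral_distr) auto

lemma integrable_uniform_angle:
  fixes f :: "complex \<Rightarrow> 'b::{banach, second_countable_topology}"
  assumes "continuous_on UNIV f"
  shows "integrable uniform_angle (\<lambda>\<theta>. f (cis \<theta>))"
proof -
  interpret prob_space uniform_angle by (rule prob_space_uniform_angle)
  have "bounded (f ` sphere 0 1)"
    using assms by (intro compact_imp_bounded compact_continuous_image continuous_on_subset[OF assms]) auto
  then obtain B where B: "\<And>z. z \<in> sphere 0 1 \<Longrightarrow> norm (f z) \<le> B" unfolding bounded_iff by blast
  have "(\<lambda>\<theta>. f (cis \<theta>)) \<in> borel_measurable borel"
    using borel_measurable_continuous_onI[OF assms] by measurable
  then have "(\<lambda>\<theta>. f (cis \<theta>)) \<in> borel_measurable uniform_angle"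
    by (simp add: uniform_measure_def)
  then show ?thesis using B[of "cis _"] by (intro integrable_const_bound[of _ B]) auto
qed

lemma integral_power_uniform_angle:
  assumes "k \<ge> 1"
  shows "(\<integral>\<theta>. cis \<theta> ^ k \<partial>uniform_angle) = 0"
proof -
  have "integral\<^sup>L lborel (\<lambda>\<theta>. indicator {0..2 * pi} \<theta> *\<^sub>R cis (real k * \<theta>))
      = cis (real k * (2 * pi)) / (\<i> * of_nat k) - cis (real k * 0) / (\<i> * of_nat k)"
  proof (intro integral_FTC_atLeastAtMost)
    fix x :: real
    have "((\<lambda>z. exp (\<i> * of_nat k * z) / (\<i> * of_nat k)) has_field_derivative exp (\<i> * of_nat k * of_real x)) (at (of_real x))"
      using assms by (auto intro!: derivative_eq_intros)
    from has_vector_derivative_real_field[OF this]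
    show "((\<lambda>x. cis (real k * x) / (\<i> * of_nat k)) has_vector_derivative cis (real k * x)) (at x within {0..2 * pi})"
      by (simp add: cis_conv_exp mult.assoc)
  qed (auto intro!: continuous_intros)
  also have "cis (real k * (2 * pi)) = 1"
    using cis_multiple_2pi[of "real k"] by (simp add: mult_ac)
  finally have *: "integral\<^sup>L lborel (\<lambda>\<theta>. indicator {0..2 * pi} \<theta> *\<^sub>R cis (real k * \<theta>)) = 0" by simp
  have "(\<integral>\<theta>. cis \<theta> ^ k \<partial>uniform_angle)
    = (\<integral>\<theta>. cis \<theta> ^ k \<partial>density lborel (\<lambda>x. ennreal (indicator {0..2 * pi} x / (2 * pi))))"
    unfolding uniform_measure_def by (intro arg_cong2[of _ _ _ _ "integral\<^sup>L"] density_cong)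
      (use divide_ennreal[of 1 "2 * pi"] in \<open>auto simp: indicator_def\<close>)
  also have "\<dots> = (\<integral>\<theta>. (indicator {0..2 * pi} \<theta> / (2 * pi)) *\<^sub>R cis \<theta> ^ k \<partial>lborel)"
    by (rule integral_density) auto
  also have "\<dots> = (\<integral>\<theta>. (1 / (2 * pi)) *\<^sub>R (indicator {0..2 * pi} \<theta> *\<^sub>R cis (real k * \<theta>)) \<partial>lborel)"
    by (simp add: Complex.DeMoivre)
  also have "\<dots> = 0" using * by (simp only: integral_scaleR_right scaleR_zero_right)
  finally show ?thesis .
qed

lemma integral_poly_uniform_angle: "(\<integral>\<theta>. poly T (cis \<theta>) \<partial>uniform_angle) = coeff T 0"
proof -
  interpret prob_space uniform_angle by (rule prob_space_uniform_angle)
  have "(\<integral>\<theta>. poly T (cis \<theta>) \<partial>uniform_angle) = (\<Sum>i\<le>degree T. coeff T i * (\<integral>\<theta>. cis \<theta> ^ i \<partial>uniform_angle))"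
    unfolding poly_altdef
    by (subst Bochner_Integration.integral_sum)
       (auto intro!: integrable_mult_right integrable_uniform_angle[of "\<lambda>z. z ^ _"] continuous_intros)
  also have "\<dots> = (\<Sum>i\<le>degree T. if i = 0 then coeff T 0 else 0)"
    by (intro sum.cong refl) (auto simp: integral_power_uniform_angle prob_space)
  also have "\<dots> = coeff T 0" by simp
  finally show ?thesis .
qed

lemma integral_uniform_circle_approx:
  fixes f :: "complex \<Rightarrow> real"
  assumes f: "continuous_on UNIV f" and T: "\<And>z. cmod z = 1 \<Longrightarrow> \<bar>f z - Re (poly T z)\<bar> < e"
  shows "\<bar>(\<integral>z. f z \<partial>uniform_circle) - Re (coeff T 0)\<bar> \<le> e"
proof -
  interpret prob_space uniform_angle by (rule prob_space_uniform_angle)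
  have i1: "integrable uniform_angle (\<lambda>\<theta>. f (cis \<theta>))" by (rule integrable_uniform_angle[OF f])
  have i2: "integrable uniform_angle (\<lambda>\<theta>. poly T (cis \<theta>))"
    by (intro integrable_uniform_angle continuous_intros)
  have "(\<integral>\<theta>. Re (poly T (cis \<theta>)) \<partial>uniform_angle) = Re (coeff T 0)"
    using i2 integral_poly_uniform_angle[of T] by (simp only: integral_Re)
  then have "(\<integral>z. f z \<partial>uniform_circle) - Re (coeff T 0) = (\<integral>\<theta>. f (cis \<theta>) - Re (poly T (cis \<theta>)) \<partial>uniform_angle)"
    using i1 i2 f by (subst integral_uniform_circle) (auto intro: borel_measurable_continuous_onI)
  also have "\<bar>\<dots>\<bar> \<le> (\<integral>\<theta>. \<bar>f (cis \<theta>) - Re (poly T (cis \<theta>))\<bar> \<partial>uniform_angle)"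
    by (rule integral_abs_bound)
  also have "\<dots> \<le> e"
    using i1 i2 T by (intro integral_le_const) (auto intro!: AE_I2 less_imp_le)
  finally show ?thesis .
qed

text \<open>Inside the disc of radius 2 the set where the bound fails is compact and misses the
  circle, so it stays at positive distance from it.\<close>

lemma annulus_near_circle:
  fixes g :: "complex \<Rightarrow> real"
  assumes g: "continuous_on UNIV g" and e: "\<And>z. cmod z = 1 \<Longrightarrow> \<bar>g z\<bar> < e"
  obtains r where "0 < r" "r < 1" "\<And>z. r < cmod z \<Longrightarrow> cmod z < 1 / r \<Longrightarrow> \<bar>g z\<bar> < e"
proof -
  define S where "S = cball 0 2 \<inter> {z. e \<le> \<bar>g z\<bar>}"
  have "closed {z. e \<le> \<bar>g z\<bar>}" using g by (intro closed_Collect_le continuous_intros)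
  then have cS: "compact S" unfolding S_def by (intro compact_Int_closed) auto
  have "\<exists>d>0. \<forall>z\<in>S. d \<le> \<bar>cmod z - 1\<bar>"
  proof (cases "S = {}")
    case False
    have "continuous_on S (\<lambda>z. \<bar>cmod z - 1\<bar>)" by (intro continuous_intros)
    then obtain x where x: "x \<in> S" "\<And>y. y \<in> S \<Longrightarrow> \<bar>cmod x - 1\<bar> \<le> \<bar>cmod y - 1\<bar>"
      using continuous_attains_inf[OF cS False] by blast
    then have "cmod x \<noteq> 1" using e unfolding S_def by fastforce
    then show ?thesis using x by (intro exI[of _ "\<bar>cmod x - 1\<bar>"]) auto
  qed (auto intro: exI[of _ 1])
  then obtain d where d: "d > 0" "\<And>z. z \<in> S \<Longrightarrow> d \<le> \<bar>cmod z - 1\<bar>" by blast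
  \<comment> \<open>Capping at 1 keeps the annulus inside the disc of radius 2. With
    \<open>r = 1 / (1 + d')\<close> the outer radius is \<open>1 + d'\<close> and the inner one
    exceeds \<open>1 - d'\<close>.\<close>
  define d' where "d' = min d 1"
  have d': "0 < d'" "d' \<le> 1" "d' \<le> d" using d by (auto simp: d'_def)
  define r where "r = 1 / (1 + d')"
  have "1 - d' < r" unfolding r_def using d' by (simp add: field_simps)
  moreover have "0 < r" "r < 1" "1 / r = 1 + d'" unfolding r_def using d' by (auto simp: field_simps)
  moreover have "\<bar>g z\<bar> < e" if "r < cmod z" "cmod z < 1 / r" for z
  proof (rule ccontr)
    assume "\<not> ?thesis"
    then have "z \<in> S" using that d' \<open>1 / r = 1 + d'\<close> by (auto simp: S_def)
    then show False using d(2)[of z] that d' calculation by auto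
  qed
  ultimately show thesis using that by blast
qed

section \<open>From good polynomials to weak* neighbourhoods\<close>

lemma sum_mset_indicator_le:
  fixes g :: "'a \<Rightarrow> real"
  assumes "\<And>x. x \<in># X \<Longrightarrow> \<bar>g x\<bar> \<le> a + (if P x then b else 0) + (if Q x then b else 0)"
  shows "\<bar>\<Sum>x\<in>#X. g x\<bar> \<le> a * size X + b * size {#x \<in># X. P x#} + b * size {#x \<in># X. Q x#}"
  using assms
proof (induction X)
  case (add x X)
  then have "\<bar>\<Sum>x\<in>#X. g x\<bar> \<le> a * size X + b * size {#x \<in># X. P x#} + b * size {#x \<in># X. Q x#}"
    by simp
  moreover have "\<bar>g x\<bar> \<le> a + (if P x then b else 0) + (if Q x then b else 0)"
    using add.prems by simp
  ultimately show ?case by (auto simp: algebra_simps split: if_splits)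
qed simp

lemma sum_mset_diff_real: "(\<Sum>x\<in>#X. f x) - (\<Sum>x\<in>#X. g x) = (\<Sum>x\<in>#X. f x - g x :: real)"
  by (induction X) auto

lemma sum_mset_poly:
  fixes T :: "complex poly"
  shows "(\<Sum>x\<in>#X. poly T (g x)) = (\<Sum>k\<le>degree T. coeff T k * (\<Sum>x\<in>#X. g x ^ k))"
  by (induction X) (simp_all add: poly_altdef sum.distrib ring_distribs)

text \<open>The test function is replaced by \<open>h = Re (poly T (fold_disc z))\<close>, which is
  bounded on the plane and close to \<open>f\<close> near the circle. The sum of \<open>h\<close>
  over the roots is a combination of power sums of folded roots, of which only the constant term
  survives; that term is close to the integral over the circle.\<close>

lemma zero_counting_close:
  fixes f :: "complex \<Rightarrow> real"
  assumes f: "continuous_on UNIV f" and bdd: "bounded (range f)" and \<delta>: "\<delta> > 0"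
  shows "\<exists>\<epsilon>>0. \<forall>n\<ge>1. \<forall>p. good n \<epsilon> p \<longrightarrow>
    \<bar>(\<integral>z. f z \<partial>zero_counting n p) - (\<integral>z. f z \<partial>uniform_circle)\<bar> < \<delta>"
proof -
  obtain T where T: "\<And>z. cmod z = 1 \<Longrightarrow> \<bar>f z - Re (poly T z)\<bar> < \<delta> / 4"
    using approx_circle[of f "\<delta> / 4"] continuous_on_subset[OF f] \<delta> by auto
  define h where "h = (\<lambda>z. Re (poly T (fold_disc z)))"
  define a where "a = Re (coeff T 0)"
  define m where "m = (\<integral>z. f z \<partial>uniform_circle)"
  have m: "\<bar>m - a\<bar> \<le> \<delta> / 4"
    unfolding m_def a_def using f T by (rule integral_uniform_circle_approx)
  have h: "continuous_on UNIV h"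
    unfolding h_def by (intro continuous_intros continuous_on_fold_disc)
  obtain r where r: "0 < r" "r < 1" "\<And>z. r < cmod z \<Longrightarrow> cmod z < 1 / r \<Longrightarrow> \<bar>f z - h z\<bar> < \<delta> / 4"
  proof (rule annulus_near_circle[of "\<lambda>z. f z - h z" "\<delta> / 4"])
    show "continuous_on UNIV (\<lambda>z. f z - h z)" using f h by (intro continuous_intros)
  qed (use T in \<open>auto simp: h_def\<close>)
  obtain Bf where Bf: "\<And>z. \<bar>f z\<bar> \<le> Bf" using bdd by (auto simp: bounded_iff)
  obtain Bh where Bh: "\<And>z. \<bar>h z\<bar> \<le> Bh"
  proof -
    have "compact (poly T ` cball 0 1)" by (intro compact_continuous_image continuous_intros) auto
    then have "bounded (poly T ` cball 0 1)" by (rule compact_imp_bounded)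
    then obtain B where "\<And>z. z \<in> cball 0 1 \<Longrightarrow> cmod (poly T z) \<le> B"
      unfolding bounded_iff by blast
    then have "\<bar>h z\<bar> \<le> B" for z
      unfolding h_def using norm_fold_disc abs_Re_le_cmod by (metis mem_cball_0 order_trans)
    then show thesis using that by blast
  qed
  have B: "Bf + Bh \<ge> 0" using Bf[of 0] Bh[of 0] by linarith
  define L where "L = 1 + 2 / ln (1 / r)"
  have L: "L \<ge> 0" unfolding L_def using r by simp
  \<comment> \<open>The three summands pay for the roots outside the annulus on either side, for the
    power sums, and for the missing roots when \<open>degree p < n\<close>.\<close>
  define C where "C = 2 * (Bf + Bh) * L + (\<Sum>k\<in>{1..degree T}. cmod (coeff T k) * (6 * real k)) + \<bar>a\<bar>"
  have C: "C \<ge> 0" unfolding C_def using B L by (intro add_nonneg_nonneg[OF add_nonneg_nonneg] mult_nonneg_nonneg sum_nonneg) auto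
  \<comment> \<open>This makes \<open>C * \<epsilon>\<close> at most \<open>\<delta> / 4\<close>,
    for a total error of \<open>3 / 4 * \<delta>\<close>; adding 1 to \<open>C\<close> covers
    \<open>C = 0\<close>.\<close>
  define \<epsilon> where "\<epsilon> = \<delta> / (4 * (C + 1))"
  have \<epsilon>: "\<epsilon> > 0" unfolding \<epsilon>_def using C \<delta> by simp
  have "C * \<epsilon> \<le> \<delta> / 4"
  proof -
    have "C * \<epsilon> \<le> (C + 1) * \<epsilon>" using \<epsilon> by (intro mult_right_mono) auto
    also have "\<dots> = \<delta> / 4" unfolding \<epsilon>_def using C by (simp add: field_simps)
    finally show ?thesis .
  qed
  moreover have "\<bar>(\<integral>z. f z \<partial>zero_counting n p) - m\<bar> \<le> \<delta> / 4 + C * \<epsilon> + \<delta> / 4"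
    if n: "n \<ge> 1" and g: "good n \<epsilon> p" for n p
  proof -
    define d where "d = degree p"
    have d: "d \<le> n" "real n - real d \<le> \<epsilon> * real n"
      using good_degree[OF g n \<epsilon>] good_degree_ge[OF g n \<epsilon>] by (auto simp: d_def)
    have N: "real (size {#x \<in># proots p. cmod x \<le> r#}) \<le> \<epsilon> * real n * L"
      "real (size {#x \<in># proots p. cmod x \<ge> 1 / r#}) \<le> \<epsilon> * real n * L"
      unfolding L_def using r by (intro good_small_roots good_large_roots g n \<epsilon>; simp)+
    have "\<bar>\<Sum>x\<in>#proots p. f x - h x\<bar> \<le> \<delta> / 4 * size (proots p) +
        (Bf + Bh) * size {#x \<in># proots p. cmod x \<le> r#} + (Bf + Bh) * size {#x \<in># proots p. cmod x \<ge> 1 / r#}"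
    proof (rule sum_mset_indicator_le)
      fix x
      have "\<bar>f x - h x\<bar> \<le> Bf + Bh" using Bf[of x] Bh[of x] by linarith
      then show "\<bar>f x - h x\<bar> \<le> \<delta> / 4 + (if cmod x \<le> r then Bf + Bh else 0) + (if 1 / r \<le> cmod x then Bf + Bh else 0)"
        using r(3)[of x] B \<delta> by (auto simp: not_le)
    qed
    also have "\<dots> \<le> \<delta> / 4 * real n + (Bf + Bh) * (\<epsilon> * real n * L) + (Bf + Bh) * (\<epsilon> * real n * L)"
      using d N B \<delta> by (intro add_mono mult_left_mono) (auto simp: size_proots_complex d_def)
    finally have 1: "\<bar>(\<Sum>x\<in>#proots p. f x) - (\<Sum>x\<in>#proots p. h x)\<bar> \<le> \<delta> / 4 * real n + 2 * (Bf + Bh) * L * (\<epsilon> * real n)"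
      unfolding sum_mset_diff_real by (simp add: algebra_simps)
    have "(\<Sum>x\<in>#proots p. h x) = Re (\<Sum>x\<in>#proots p. poly T (fold_disc x))"
    proof -
      have "(\<Sum>x\<in>#X. h x) = Re (\<Sum>x\<in>#X. poly T (fold_disc x))" for X
        unfolding h_def by (induction X) auto
      then show ?thesis .
    qed
    also have "(\<Sum>x\<in>#proots p. poly T (fold_disc x)) = (\<Sum>k\<le>degree T. coeff T k * (\<Sum>x\<in>#proots p. fold_disc x ^ k))"
      by (rule sum_mset_poly)
    also have "\<dots> = coeff T 0 * of_nat d + (\<Sum>k\<in>{1..degree T}. coeff T k * (\<Sum>x\<in>#proots p. fold_disc x ^ k))"
    proof -
      have "{..degree T} = insert 0 {1..degree T}" by auto
      then show ?thesis by (simp add: d_def size_proots_complex)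
    qed
    finally have "\<bar>(\<Sum>x\<in>#proots p. h x) - a * real d\<bar> = \<bar>Re (\<Sum>k\<in>{1..degree T}. coeff T k * (\<Sum>x\<in>#proots p. fold_disc x ^ k))\<bar>"
      by (simp add: a_def)
    also have "\<dots> \<le> cmod (\<Sum>k\<in>{1..degree T}. coeff T k * (\<Sum>x\<in>#proots p. fold_disc x ^ k))"
      by (rule abs_Re_le_cmod)
    also have "\<dots> \<le> (\<Sum>k\<in>{1..degree T}. cmod (coeff T k) * (6 * real k * (\<epsilon> * real n)))"
      using good_power_sums[OF g n \<epsilon>]
      by (intro order_trans[OF norm_sum] sum_mono) (auto simp: norm_mult intro!: mult_left_mono)
    also have "\<dots> = (\<Sum>k\<in>{1..degree T}. cmod (coeff T k) * (6 * real k)) * (\<epsilon> * real n)"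
      by (simp add: sum_distrib_right mult.assoc)
    finally have 2: "\<bar>(\<Sum>x\<in>#proots p. h x) - a * real d\<bar>
      \<le> (\<Sum>k\<in>{1..degree T}. cmod (coeff T k) * (6 * real k)) * (\<epsilon> * real n)" .
    \<comment> \<open>The zeroth power sum is the number \<open>d\<close> of roots, whereas the zero
      measure is normalised by \<open>n\<close>.\<close>
    have "\<bar>a * real d - a * real n\<bar> = \<bar>a\<bar> * (real n - real d)"
      using d by (simp add: abs_mult flip: right_diff_distrib)
    also have "\<dots> \<le> \<bar>a\<bar> * (\<epsilon> * real n)" using d by (intro mult_left_mono) auto
    finally have 3: "\<bar>a * real d - a * real n\<bar> \<le> \<bar>a\<bar> * (\<epsilon> * real n)" .
    have "\<bar>(\<Sum>x\<in>#proots p. f x) - a * real n\<bar> \<le> \<delta> / 4 * real n + C * (\<epsilon> * real n)"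
      using 1 2 3 unfolding C_def distrib_right by linarith
    then have "\<bar>(\<Sum>x\<in>#proots p. f x) / real n - a\<bar> \<le> \<delta> / 4 + C * \<epsilon>"
      using n by (simp add: abs_le_iff field_simps)
    moreover have "(\<integral>z. f z \<partial>zero_counting n p) = (\<Sum>x\<in>#proots p. f x) / real n"
      using f by (intro integral_zero_counting borel_measurable_continuous_onI)
    ultimately show ?thesis using m by linarith
  qed
  ultimately have "\<bar>(\<integral>z. f z \<partial>zero_counting n p) - m\<bar> < \<delta>" if "n \<ge> 1" "good n \<epsilon> p" for n p
    using that \<delta> by fastforce
  then show ?thesis using \<epsilon> unfolding m_def by blast
qed

lemma good_mono:
  assumes "good n \<epsilon> p" "\<epsilon> \<le> \<epsilon>'"
  shows "good n \<epsilon>' p"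
proof -
  have *: "\<epsilon> * real n \<le> \<epsilon>' * real n" using assms(2) by (intro mult_right_mono) auto
  have "x \<le> exp (\<epsilon>' * real n)" if "x \<le> exp (\<epsilon> * real n)" for x
    using that * by (meson exp_le_cancel_iff order_trans)
  moreover have "real j \<le> \<epsilon>' * real n" if "real j \<le> \<epsilon> * real n" for j
    using that * by linarith
  moreover have "real (n choose j) * exp (- \<epsilon>' * real n) \<le> x" if "real (n choose j) * exp (- \<epsilon> * real n) \<le> x" for j x
  proof -
    have "real (n choose j) * exp (- \<epsilon>' * real n) \<le> real (n choose j) * exp (- \<epsilon> * real n)"
      using * by (intro mult_left_mono) auto
    then show ?thesis using that by linarith
  qed
  ultimately show ?thesis using assms(1) unfolding good_def by blast
qed

text \<open>Induction on how the open set is generated: subbasic sets are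
  \<open>zero_counting_close\<close>, and a finite intersection takes the smaller \<epsilon> by
  \<open>good_mono\<close>.\<close>

lemma good_imp_near_uniform_circle:
  assumes "openin weak_star U" "uniform_circle \<in> U"
  shows "\<exists>\<epsilon>>0. \<forall>n\<ge>1. \<forall>p. good n \<epsilon> p \<longrightarrow> zero_counting n p \<in> U"
proof -
  have "generate_topology_on
     {{\<mu> \<in> space (subprob_algebra borel). (\<integral>z. f z \<partial>\<mu>) \<in> V} | (f :: complex \<Rightarrow> real) V.
        continuous_on UNIV f \<and> bounded (range f) \<and> open V} U"
    using assms(1) unfolding weak_star_def by (rule openin_topology_generated_by)
  then show ?thesis using assms(2)
  proof induction
    case (Int a b)
    then obtain e1 e2 where e: "e1 > 0" "e2 > 0"
      "\<And>n p. n \<ge> 1 \<Longrightarrow> good n e1 p \<Longrightarrow> zero_counting n p \<in> a"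
      "\<And>n p. n \<ge> 1 \<Longrightarrow> good n e2 p \<Longrightarrow> zero_counting n p \<in> b"
      by blast
    moreover have "good n e1 p" "good n e2 p" if "good n (min e1 e2) p" for n p
      using that by (auto elim: good_mono)
    ultimately show ?case by (intro exI[of _ "min e1 e2"]) auto
  next
    case (UN K)
    then show ?case by blast
  next
    case (Basis s)
    then obtain f :: "complex \<Rightarrow> real" and V
      where s: "s = {\<mu> \<in> space (subprob_algebra borel). (\<integral>z. f z \<partial>\<mu>) \<in> V}"
        and f: "continuous_on UNIV f" "bounded (range f)" and V: "open V" by blast
    then obtain \<delta> where \<delta>: "\<delta> > 0" "\<And>y. dist y (\<integral>z. f z \<partial>uniform_circle) < \<delta> \<Longrightarrow> y \<in> V"
      using Basis.prems unfolding open_dist by blast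
    obtain \<epsilon> where "\<epsilon> > 0" and
      "\<And>n p. n \<ge> 1 \<Longrightarrow> good n \<epsilon> p \<Longrightarrow> \<bar>(\<integral>z. f z \<partial>zero_counting n p) - (\<integral>z. f z \<partial>uniform_circle)\<bar> < \<delta>"
      using zero_counting_close[OF f \<delta>(1)] by blast
    moreover have "zero_counting n p \<in> space (subprob_algebra borel)" if "good n \<epsilon> p" for n p
      using zero_counting_in_topspace[of p n] that by (simp add: good_def topspace_weak_star)
    ultimately show ?case using \<delta>(2) by (intro exI[of _ \<epsilon>]) (auto simp: s dist_real_def)
  qed auto
qed

section \<open>Orthonormal polynomials\<close>

lemma poly_higher_deriv: "(deriv ^^ k) (poly p) = poly ((pderiv ^^ k) p)" for p :: "complex poly"
proof (induction k)
  case (Suc k)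
  have "deriv (poly r) = poly (pderiv r)" for r :: "complex poly"
    by (rule ext) (rule DERIV_imp_deriv, rule poly_DERIV)
  then show ?case by (simp add: Suc)
qed simp

lemma coeff_le_circle:
  assumes "\<And>z. cmod z = 1 \<Longrightarrow> cmod (poly p z) \<le> B"
  shows "cmod (coeff p k) \<le> B"
proof -
  have "cmod ((deriv ^^ k) (poly p) 0) \<le> fact k * B / 1 ^ k"
    by (rule Cauchy_inequality) (use assms in \<open>auto intro!: holomorphic_intros continuous_intros\<close>)
  moreover have "(deriv ^^ k) (poly p) 0 = fact k * coeff p k"
    by (simp add: poly_higher_deriv poly_0_coeff_0 coeff_higher_pderiv pochhammer_fact)
  ultimately show ?thesis by (simp add: norm_mult)
qed

text \<open>The coefficients of index \<open>n, n - 1, ...\<close> form a triangular system in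
  \<open>d n, d (n - 1), ...\<close>, with diagonal at least \<open>c\<close> and other entries at
  most \<open>B\<close>. Solving it from the top, the bounds sum to a geometric series of ratio
  \<open>1 + B / c\<close>.\<close>

lemma back_substitution:
  fixes d :: "nat \<Rightarrow> complex" and q :: "nat \<Rightarrow> complex poly"
  assumes deg: "\<And>i. i \<le> n \<Longrightarrow> degree (q i) \<le> i"
    and lc: "\<And>i. i \<le> n \<Longrightarrow> c \<le> cmod (coeff (q i) i)"
    and B: "\<And>i k. i \<le> n \<Longrightarrow> cmod (coeff (q i) k) \<le> B"
    and c: "c > 0" and \<delta>: "\<delta> \<ge> 0"
    and small: "\<And>j. j \<le> J \<Longrightarrow> j \<le> n \<Longrightarrow> cmod (coeff (\<Sum>i\<le>n. smult (d i) (q i)) (n - j)) \<le> \<delta>"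
    and j: "j \<le> J" "j \<le> n"
  shows "cmod (d (n - j)) \<le> \<delta> / c * (1 + B / c) ^ j"
  using j
proof (induction j rule: less_induct)
  case (less j)
  have B0: "B \<ge> 0" using B[of 0 0] norm_ge_zero by (metis le0 order_trans)
  have "coeff (\<Sum>i\<le>n. smult (d i) (q i)) (n - j) = (\<Sum>i\<le>n. d i * coeff (q i) (n - j))"
    by (simp add: coeff_sum)
  \<comment> \<open>Terms with \<open>i < n - j\<close> vanish because
    \<open>degree (q i) \<le> i\<close>; the others are reindexed by their distance from the
    top.\<close>
  also have "\<dots> = (\<Sum>i\<in>(\<lambda>l. n - l) ` {..j}. d i * coeff (q i) (n - j))"
  proof (rule sum.mono_neutral_right)
    show "\<forall>i\<in>{..n} - (\<lambda>l. n - l) ` {..j}. d i * coeff (q i) (n - j) = 0"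
    proof
      fix i assume i: "i \<in> {..n} - (\<lambda>l. n - l) ` {..j}"
      have "i < n - j"
      proof (rule ccontr)
        assume "\<not> i < n - j"
        then have "i = n - (n - i)" "n - i \<le> j" using i by auto
        then show False using i by blast
      qed
      then show "d i * coeff (q i) (n - j) = 0"
        using deg[of i] i by (simp add: coeff_eq_0)
    qed
  qed auto
  also have "\<dots> = (\<Sum>l\<le>j. d (n - l) * coeff (q (n - l)) (n - j))"
    using less.prems by (subst sum.reindex) (auto simp: inj_on_def)
  also have "\<dots> = d (n - j) * coeff (q (n - j)) (n - j) + (\<Sum>l<j. d (n - l) * coeff (q (n - l)) (n - j))"
    by (simp add: lessThan_Suc_atMost[symmetric])
  finally have eq: "d (n - j) * coeff (q (n - j)) (n - j) = coeff (\<Sum>i\<le>n. smult (d i) (q i)) (n - j)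
      - (\<Sum>l<j. d (n - l) * coeff (q (n - l)) (n - j))" by simp
  have "c * cmod (d (n - j)) \<le> cmod (d (n - j) * coeff (q (n - j)) (n - j))"
    using mult_right_mono[OF lc[of "n - j"], of "cmod (d (n - j))"] by (simp add: norm_mult mult.commute)
  also have "\<dots> \<le> \<delta> + (\<Sum>l<j. (\<delta> / c * (1 + B / c) ^ l) * B)"
    unfolding eq
  proof (rule order_trans[OF norm_triangle_ineq4 add_mono])
    show "cmod (coeff (\<Sum>i\<le>n. smult (d i) (q i)) (n - j)) \<le> \<delta>" using small less.prems by blast
    show "cmod (\<Sum>l<j. d (n - l) * coeff (q (n - l)) (n - j)) \<le> (\<Sum>l<j. (\<delta> / c * (1 + B / c) ^ l) * B)"
    proof (rule order_trans[OF norm_sum sum_mono])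
      fix l assume l: "l \<in> {..<j}"
      then have "cmod (d (n - l)) \<le> \<delta> / c * (1 + B / c) ^ l" using less by auto
      then show "cmod (d (n - l) * coeff (q (n - l)) (n - j)) \<le> (\<delta> / c * (1 + B / c) ^ l) * B"
        unfolding norm_mult using B[of "n - l"] c \<delta> B0 by (intro mult_mono) auto
    qed
  qed
  also have "\<dots> = \<delta> + \<delta> * ((B / c) * (\<Sum>l<j. (1 + B / c) ^ l))"
    by (simp add: sum_distrib_left sum_distrib_right mult_ac)
  also have "(B / c) * (\<Sum>l<j. (1 + B / c) ^ l) = (1 + B / c) ^ j - 1"
    using power_diff_1_eq[of "1 + B / c" j] by simp
  finally show ?case using c by (simp add: field_simps)
qed

section \<open>Polynomial norms for a Bernstein-Markov measure\<close>

locale circle_measure =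
  fixes \<tau> :: "complex measure"
  assumes on_circle: "finite_measure_on (sphere 0 1) \<tau>"
    and bm: "bernstein_markov (sphere 0 1) \<tau>"
begin

sublocale tau: finite_measure \<tau>
  using on_circle by (simp add: finite_measure_on_def)

lemma sets_tau [measurable_cong, simp]: "sets \<tau> = sets borel"
  using on_circle by (simp add: finite_measure_on_def)

lemma space_tau [simp]: "space \<tau> = UNIV"
  using sets_eq_imp_space_eq[OF sets_tau] by simp

lemma AE_circle: "AE z in \<tau>. cmod z = 1"
proof (rule AE_I')
  show "- sphere 0 1 \<in> null_sets \<tau>"
    using on_circle by (intro null_setsI) (auto simp: finite_measure_on_def)
qed auto

lemma integral_circle_le:
  assumes "g \<in> borel_measurable borel" "\<And>z. cmod z = 1 \<Longrightarrow> cmod (g z) \<le> B"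
  shows "cmod (\<integral>z. g z \<partial>\<tau>) \<le> measure \<tau> UNIV * B"
proof -
  have AE: "AE z in \<tau>. cmod (g z) \<le> B" using AE_circle assms(2) by auto
  have int: "integrable \<tau> g" using assms(1) by (intro tau.integrable_const_bound[OF AE]) auto
  have "cmod (\<integral>z. g z \<partial>\<tau>) \<le> (\<integral>z. cmod (g z) \<partial>\<tau>)" by (rule integral_norm_bound)
  also have "\<dots> \<le> (\<integral>z. B \<partial>\<tau>)" using int AE by (intro integral_mono_AE) auto
  finally show ?thesis by simp
qed

lemma L2_norm_nonneg: "L2_norm \<tau> p \<ge> 0"
  by (simp add: L2_norm_def)

lemma L2_norm_le:
  assumes "\<And>z. cmod z = 1 \<Longrightarrow> cmod (poly p z) \<le> B" "B \<ge> 0"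
  shows "L2_norm \<tau> p \<le> sqrt (measure \<tau> UNIV) * B"
proof -
  have "cmod (\<integral>z. of_real ((cmod (poly p z))\<^sup>2) \<partial>\<tau>) \<le> measure \<tau> UNIV * B\<^sup>2"
    using assms by (intro integral_circle_le) (auto simp: norm_power intro!: power_mono borel_measurable_continuous_onI continuous_intros)
  then have "(\<integral>z. (cmod (poly p z))\<^sup>2 \<partial>\<tau>) \<le> measure \<tau> UNIV * B\<^sup>2"
    by (simp only: integral_complex_of_real norm_of_real)
  then have "L2_norm \<tau> p \<le> sqrt (measure \<tau> UNIV * B\<^sup>2)"
    unfolding L2_norm_def by (rule real_sqrt_le_mono)
  then show ?thesis using assms(2) by (simp add: real_sqrt_mult)
qed

lemma L2_inner_le:
  assumes "\<And>z. cmod z = 1 \<Longrightarrow> cmod (poly p z) \<le> A" "\<And>z. cmod z = 1 \<Longrightarrow> cmod (poly q z) \<le> B"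
  shows "cmod (L2_inner \<tau> p q) \<le> measure \<tau> UNIV * (A * B)"
  unfolding L2_inner_def
proof (rule integral_circle_le)
  fix z :: complex assume "cmod z = 1"
  then show "cmod (poly p z * cnj (poly q z)) \<le> A * B"
    using assms[of z] unfolding norm_mult complex_mod_cnj by (intro mult_mono) (auto intro: order_trans[OF norm_ge_zero])
qed (intro borel_measurable_continuous_onI continuous_intros)

lemma L2_norm_smult: "L2_norm \<tau> (smult c p) = cmod c * L2_norm \<tau> p"
  by (simp add: L2_norm_def norm_mult power_mult_distrib real_sqrt_mult)

lemma bernstein_markov_circle:
  assumes "\<epsilon> > 0"
  obtains M where "M > 0" "\<And>n p z. degree p \<le> n \<Longrightarrow> cmod z = 1 \<Longrightarrow>
    cmod (poly p z) \<le> M * exp (\<epsilon> * real n) * L2_norm \<tau> p"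
proof -
  obtain M where M: "M > 0" "\<And>n p. degree p \<le> n \<Longrightarrow>
     (SUP z\<in>sphere 0 1. cmod (poly p z)) \<le> M * exp (\<epsilon> * real n) * L2_norm \<tau> p"
    using bm assms unfolding bernstein_markov_def by blast
  have "cmod (poly p z) \<le> M * exp (\<epsilon> * real n) * L2_norm \<tau> p" if "degree p \<le> n" "cmod z = 1" for n p z
  proof -
    \<comment> \<open>A real supremum bounds its members only when the set is bounded above;
      compactness of the circle provides this.\<close>
    have "compact ((\<lambda>z. cmod (poly p z)) ` sphere 0 1)"
      by (intro compact_continuous_image continuous_intros) auto
    then have "bdd_above ((\<lambda>z. cmod (poly p z)) ` sphere 0 1)"
      by (intro bounded_imp_bdd_above compact_imp_bounded)
    then have "cmod (poly p z) \<le> (SUP z\<in>sphere 0 1. cmod (poly p z))"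
      using that by (intro cSUP_upper) auto
    then show ?thesis using M(2)[OF that(1)] by linarith
  qed
  then show thesis using M(1) that by blast
qed

text \<open>If the norm were 0, the Bernstein-Markov inequality would make \<open>p\<close> vanish
  on the whole circle, which is infinite. This makes the divisions in Gram-Schmidt genuine.\<close>

lemma L2_norm_pos:
  assumes "p \<noteq> 0"
  shows "L2_norm \<tau> p > 0"
proof (rule ccontr)
  assume "\<not> ?thesis"
  then have *: "L2_norm \<tau> p = 0" using L2_norm_nonneg[of p] by linarith
  obtain M where "M > 0" and M: "\<And>n p z. degree p \<le> n \<Longrightarrow> cmod z = 1 \<Longrightarrow>
    cmod (poly p z) \<le> M * exp (1 * real n) * L2_norm \<tau> p"
    using bernstein_markov_circle[OF zero_less_one] by blast
  from M[of p "degree p"] have "poly p z = 0" if "cmod z = 1" for z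
    using that * by simp
  then have "sphere 0 1 \<subseteq> {z. poly p z = 0}" by auto
  moreover have "infinite (sphere (0::complex) 1)"
  proof
    assume "finite (sphere (0::complex) 1)"
    moreover have "connected (sphere (0::complex) 1)" by (rule connected_sphere) simp
    ultimately have "sphere (0::complex) 1 = {} \<or> (\<exists>x. sphere 0 1 = {x :: complex})"
      using connected_finite_iff_sing[of "sphere (0::complex) 1"] by simp
    then obtain x :: complex where x: "sphere 0 1 \<subseteq> {x}" by blast
    have "1 \<in> sphere (0::complex) 1" "-1 \<in> sphere (0::complex) 1" by auto
    with x have "1 = x" "-1 = x" by blast+
    then show False by simp
  qed
  ultimately show False using poly_roots_finite[OF assms] finite_subset by blast
qed

end

section \<open>Subexponential bounds for the orthonormal polynomials\<close>

locale circle_orthonormal = circle_measure +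
  fixes q :: "nat \<Rightarrow> complex poly"
  assumes gs: "gram_schmidt_monomials \<tau> q"
begin

definition gs_residual :: "nat \<Rightarrow> complex poly" where
  "gs_residual n = monom 1 n - (\<Sum>k<n. smult (L2_inner \<tau> (monom 1 n) (q k)) (q k))"

lemma q_eq: "q n = smult (1 / of_real (L2_norm \<tau> (gs_residual n))) (gs_residual n)"
  using gs unfolding gram_schmidt_monomials_def gs_residual_def Let_def by blast

text \<open>The claims are proved together: the degree of the residual depends on those of the
  earlier \<open>q k\<close>, and the degree of \<open>q n\<close> on the residual being nonzero,
  hence of positive norm.\<close>

lemma gs_residual_degree: "degree (gs_residual n) = n" and gs_residual_lead: "coeff (gs_residual n) n = 1"
  and q_degree: "degree (q n) = n"
proof (induction n rule: less_induct)
  case (less n)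
  have lower: "coeff (\<Sum>k<n. smult (L2_inner \<tau> (monom 1 n) (q k)) (q k)) i = 0" if "i \<ge> n" for i
    using less(3) that by (simp add: coeff_sum coeff_eq_0)
  show lead: "coeff (gs_residual n) n = 1"
    by (simp only: gs_residual_def coeff_diff lower[OF order_refl] coeff_monom) simp
  have "coeff (gs_residual n) i = 0" if "i > n" for i
    using that lower[of i] by (simp only: gs_residual_def coeff_diff coeff_monom) simp
  then show deg: "degree (gs_residual n) = n"
    using lead by (intro antisym degree_le le_degree) auto
  have "gs_residual n \<noteq> 0" using lead by auto
  then have "L2_norm \<tau> (gs_residual n) > 0" by (rule L2_norm_pos)
  then show "degree (q n) = n" using deg by (subst q_eq) simp
qed

lemma gs_residual_norm_pos: "L2_norm \<tau> (gs_residual n) > 0"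
  using gs_residual_lead[of n] by (intro L2_norm_pos) auto

lemma L2_norm_q: "L2_norm \<tau> (q n) = 1"
  using gs_residual_norm_pos[of n] by (subst q_eq) (simp add: L2_norm_smult norm_divide)

lemma coeff_q_diag: "coeff (q n) n = 1 / of_real (L2_norm \<tau> (gs_residual n))"
  by (subst q_eq) (simp add: gs_residual_lead)

lemma q_circle_le:
  assumes "\<epsilon> > 0"
  obtains M where "M > 0" "\<And>n z. cmod z = 1 \<Longrightarrow> cmod (poly (q n) z) \<le> M * exp (\<epsilon> * real n)"
proof -
  obtain M where "M > 0" "\<And>n p z. degree p \<le> n \<Longrightarrow> cmod z = 1 \<Longrightarrow>
    cmod (poly p z) \<le> M * exp (\<epsilon> * real n) * L2_norm \<tau> p"
    using bernstein_markov_circle[OF assms] by blast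
  from this(1) this(2)[of "q _"] show thesis
    by (intro that[of M]) (simp_all add: q_degree L2_norm_q)
qed

text \<open>The leading coefficient is the reciprocal of the norm of the residual, so that norm must
  grow subexponentially. On the circle each of the \<open>n\<close> projection terms is
  subexponential by \<open>q_circle_le\<close>.\<close>

lemma q_lead_ge:
  assumes "\<epsilon> > 0"
  obtains c where "c > 0" "\<And>n. c * exp (- \<epsilon> * real n) \<le> cmod (coeff (q n) n)"
proof -
  \<comment> \<open>One factor \<open>exp (e * n)\<close> comes from the inner product, one from the
    value of \<open>q k\<close>, and the third absorbs the number \<open>n\<close> of terms.\<close>
  define e where "e = \<epsilon> / 3"
  have e: "e > 0" using assms by (simp add: e_def)
  obtain M where M: "M > 0" "\<And>n z. cmod z = 1 \<Longrightarrow> cmod (poly (q n) z) \<le> M * exp (e * real n)"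
    using q_circle_le[OF e] by blast
  define T where "T = measure \<tau> UNIV"
  have T: "T \<ge> 0" by (simp add: T_def)
  define C where "C = 1 + T * M\<^sup>2 / e"
  have C: "C \<ge> 1" unfolding C_def using T e by simp
  have "L2_norm \<tau> (gs_residual n) \<le> sqrt T * (C * exp (\<epsilon> * real n))" for n
    unfolding T_def
  proof (rule L2_norm_le)
    fix z :: complex assume z: "cmod z = 1"
    define E where "E = exp (e * real n)"
    have E: "E \<ge> 1" using e by (simp add: E_def)
    have "cmod (poly (gs_residual n) z) \<le> cmod (z ^ n) + cmod (\<Sum>k<n. L2_inner \<tau> (monom 1 n) (q k) * poly (q k) z)"
      unfolding gs_residual_def by (simp add: poly_monom poly_sum norm_triangle_ineq4)
    also have "\<dots> \<le> 1 + (\<Sum>k<n. (T * (1 * (M * E))) * (M * E))"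
    proof (rule add_mono)
      show "cmod (\<Sum>k<n. L2_inner \<tau> (monom 1 n) (q k) * poly (q k) z) \<le> (\<Sum>k<n. (T * (1 * (M * E))) * (M * E))"
      proof (rule order_trans[OF norm_sum sum_mono])
        fix k assume k: "k \<in> {..<n}"
        have ME: "cmod (poly (q k) w) \<le> M * E" if "cmod w = 1" for w
        proof -
          have "M * exp (e * real k) \<le> M * E" unfolding E_def using k e M(1) by simp
          then show ?thesis using M(2)[OF that, of k] by linarith
        qed
        have "cmod (L2_inner \<tau> (monom 1 n) (q k)) \<le> T * (1 * (M * E))"
          unfolding T_def by (intro L2_inner_le ME) (auto simp: poly_monom norm_power)
        then show "cmod (L2_inner \<tau> (monom 1 n) (q k) * poly (q k) z) \<le> (T * (1 * (M * E))) * (M * E)"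
          unfolding norm_mult using ME[OF z] T M(1) E by (intro mult_mono) auto
      qed
    qed (simp add: norm_power z)
    also have "\<dots> = 1 + T * M\<^sup>2 * E\<^sup>2 * real n" by (simp add: power2_eq_square)
    also have "\<dots> \<le> E ^ 3 + T * M\<^sup>2 * E\<^sup>2 * (E / e)"
    proof (intro add_mono mult_left_mono)
      have "e * real n \<le> E" unfolding E_def using exp_ge_add_one_self[of "e * real n"] by linarith
      then show "real n \<le> E / e" using e by (simp add: field_simps)
    qed (use E T in auto)
    also have "\<dots> = C * E ^ 3" by (simp add: C_def algebra_simps power2_eq_square power3_eq_cube)
    also have "E ^ 3 = exp (\<epsilon> * real n)" by (simp add: E_def e_def flip: exp_of_nat_mult)
    finally show "cmod (poly (gs_residual n) z) \<le> C * exp (\<epsilon> * real n)" .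
  qed (use C in auto)
  then have *: "L2_norm \<tau> (gs_residual n) \<le> (sqrt T + 1) * C * exp (\<epsilon> * real n)" for n
  proof (rule order_trans)
    show "sqrt T * (C * exp (\<epsilon> * real n)) \<le> (sqrt T + 1) * C * exp (\<epsilon> * real n)" for n
      using C by (simp add: algebra_simps)
  qed
  have pos: "(sqrt T + 1) * C > 0" using T C by (intro mult_pos_pos) (auto intro: add_nonneg_pos)
  have "1 / ((sqrt T + 1) * C) * exp (- \<epsilon> * real n) \<le> cmod (coeff (q n) n)" for n
  proof -
    have "1 / ((sqrt T + 1) * C) * exp (- \<epsilon> * real n) = 1 / ((sqrt T + 1) * C * exp (\<epsilon> * real n))"
      by (simp add: exp_minus field_simps)
    also have "\<dots> \<le> 1 / L2_norm \<tau> (gs_residual n)"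
      using *[of n] gs_residual_norm_pos[of n] by (intro divide_left_mono) (auto intro!: mult_pos_pos simp: pos)
    also have "\<dots> = cmod (coeff (q n) n)"
      using gs_residual_norm_pos[of n] by (simp add: coeff_q_diag norm_divide)
    finally show ?thesis .
  qed
  then show thesis using pos by (intro that[of "1 / ((sqrt T + 1) * C)"]) auto
qed

end

section \<open>Heavy-tailed coefficients\<close>

lemma power_times_exp_decay:
  fixes a :: real
  assumes "a > 0"
  shows "(\<lambda>n. real n ^ J * exp (- a * real n)) \<longlonglongrightarrow> 0"
proof -
  have "filterlim (\<lambda>n. a * real n) at_top sequentially"
    using assms by (intro filterlim_tendsto_pos_mult_at_top[OF tendsto_const] filterlim_real_sequentially) auto
  then have "(\<lambda>n. (a * real n) ^ J / exp (a * real n)) \<longlonglongrightarrow> 0"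
    by (rule filterlim_compose[OF tendsto_power_div_exp_0])
  then have "(\<lambda>n. inverse (a ^ J) * ((a * real n) ^ J / exp (a * real n))) \<longlonglongrightarrow> inverse (a ^ J) * 0"
    by (intro tendsto_mult tendsto_const)
  then show ?thesis using assms by (simp add: power_mult_distrib exp_minus field_simps)
qed

lemma coeff_random_poly: "coeff (random_poly \<xi> q n \<omega>) j = (\<Sum>i\<le>n. \<xi> i \<omega> * coeff (q i) j)"
  by (simp add: random_poly_def coeff_sum)

lemma (in prob_space) prob_indep_var_le:
  assumes ind: "indep_var N1 X N2 Y" and S: "S \<in> sets (N1 \<Otimes>\<^sub>M N2)" and b: "b \<ge> 0"
    and le: "\<And>y. y \<in> space N2 \<Longrightarrow> prob {\<omega> \<in> space M. (X \<omega>, y) \<in> S} \<le> b"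
  shows "prob {\<omega> \<in> space M. (X \<omega>, Y \<omega>) \<in> S} \<le> b"
proof -
  have X: "X \<in> measurable M N1" and Y: "Y \<in> measurable M N2"
    and eq: "distr M N1 X \<Otimes>\<^sub>M distr M N2 Y = distr M (N1 \<Otimes>\<^sub>M N2) (\<lambda>\<omega>. (X \<omega>, Y \<omega>))"
    using ind unfolding indep_var_distribution_eq by auto
  interpret P: pair_prob_space "distr M N1 X" "distr M N2 Y"
    unfolding pair_prob_space_def pair_sigma_finite_def
    using X Y by (auto intro!: prob_space_distr prob_space_imp_sigma_finite)
  have S': "S \<in> sets (distr M N1 X \<Otimes>\<^sub>M distr M N2 Y)" using S by simp
  have "emeasure M {\<omega> \<in> space M. (X \<omega>, Y \<omega>) \<in> S} = emeasure (distr M (N1 \<Otimes>\<^sub>M N2) (\<lambda>\<omega>. (X \<omega>, Y \<omega>))) S"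
    using S X Y by (subst emeasure_distr) (auto intro!: arg_cong[where f = "emeasure M"])
  also have "\<dots> = (\<integral>\<^sup>+y. emeasure (distr M N1 X) ((\<lambda>x. (x, y)) -` S) \<partial>distr M N2 Y)"
    unfolding eq[symmetric] by (rule P.emeasure_pair_measure_alt2[OF S'])
  also have "\<dots> \<le> (\<integral>\<^sup>+y. ennreal b \<partial>distr M N2 Y)"
  proof (rule nn_integral_mono)
    fix y assume "y \<in> space (distr M N2 Y)"
    then have y: "y \<in> space N2" by simp
    have "(\<lambda>x. (x, y)) -` S \<in> sets N1" by (rule sets_Pair2[OF S])
    then have "emeasure (distr M N1 X) ((\<lambda>x. (x, y)) -` S) = emeasure M {\<omega> \<in> space M. (X \<omega>, y) \<in> S}"
      using X by (subst emeasure_distr) (auto intro!: arg_cong[where f = "emeasure M"])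
    also have "\<dots> \<le> ennreal b"
      unfolding emeasure_eq_measure using le[OF y] by (rule ennreal_leI)
    finally show "emeasure (distr M N1 X) ((\<lambda>x. (x, y)) -` S) \<le> ennreal b" .
  qed
  also have "\<dots> = ennreal b" using P.M2.emeasure_space_1 by simp
  finally show ?thesis unfolding emeasure_eq_measure using b by simp
qed

section \<open>Tails and small-ball bounds for the coefficients\<close>

locale heavy_tailed_iid = prob_space M for M :: "'a measure" +
  fixes \<xi> :: "nat \<Rightarrow> 'a \<Rightarrow> complex"
  assumes indep: "indep_vars (\<lambda>_. borel) \<xi> UNIV"
    and ident: "\<And>i. distr M borel (\<xi> i) = distr M borel (\<xi> 0)"
    and heavy: "(\<integral>\<^sup>+ \<omega>. ennreal (ln (1 + cmod (\<xi> 0 \<omega>))) \<partial>M) = \<infinity>"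
    and tail: "(\<lambda>t. prob {\<omega> \<in> space M. cmod (\<xi> 0 \<omega>) > exp t}) \<in> o[at_top](\<lambda>t::real. 1 / t)"
begin

lemma xi_measurable [measurable]: "\<xi> i \<in> borel_measurable M"
  using indep by (simp add: indep_vars_def)

lemma prob_xi_eq:
  assumes "A \<in> sets borel"
  shows "prob {\<omega> \<in> space M. \<xi> i \<omega> \<in> A} = prob {\<omega> \<in> space M. \<xi> 0 \<omega> \<in> A}"
proof -
  have "prob {\<omega> \<in> space M. \<xi> i \<omega> \<in> A} = measure (distr M borel (\<xi> i)) A" for i
    using assms by (subst measure_distr) (auto intro!: arg_cong[where f = prob])
  then show ?thesis using ident[of i] by simp
qed

text \<open>An almost sure bound on \<open>\<xi> 0\<close> would make the logarithmic moment
  finite.\<close>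

lemma xi_unbounded: "prob {\<omega> \<in> space M. cmod (\<xi> 0 \<omega>) > R} > 0"
proof (rule ccontr)
  assume "\<not> ?thesis"
  then have "prob {\<omega> \<in> space M. cmod (\<xi> 0 \<omega>) > R} = 0"
    using measure_nonneg[of M] by (simp add: not_less order.antisym)
  then have "AE \<omega> in M. \<not> cmod (\<xi> 0 \<omega>) > R" by (subst (asm) prob_eq_0) auto
  then have "AE \<omega> in M. ennreal (ln (1 + cmod (\<xi> 0 \<omega>))) \<le> ennreal (ln (1 + \<bar>R\<bar>))"
  proof eventually_elim
    case (elim \<omega>)
    then have "1 + cmod (\<xi> 0 \<omega>) \<le> 1 + \<bar>R\<bar>" by linarith
    moreover have "0 < 1 + cmod (\<xi> 0 \<omega>)" using norm_ge_zero[of "\<xi> 0 \<omega>"] by linarith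
    ultimately show ?case by (intro ennreal_leI ln_mono) auto
  qed
  then have "(\<integral>\<^sup>+ \<omega>. ennreal (ln (1 + cmod (\<xi> 0 \<omega>))) \<partial>M) \<le> (\<integral>\<^sup>+ \<omega>. ennreal (ln (1 + \<bar>R\<bar>)) \<partial>M)"
    by (rule nn_integral_mono_AE)
  also have "\<dots> < \<infinity>" by (simp add: emeasure_space_1)
  finally show False using heavy by simp
qed

text \<open>The tail condition at \<open>t = \<epsilon> * n\<close>; the factor \<open>n + 1\<close>
  counts the variables in the union bound over \<open>\<xi> 0, ..., \<xi> n\<close>.\<close>

lemma tail_lim: "(\<lambda>n. (real n + 1) * prob {\<omega> \<in> space M. cmod (\<xi> 0 \<omega>) > exp (\<epsilon> * real n)}) \<longlonglongrightarrow> 0"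
  if \<epsilon>: "\<epsilon> > 0"
proof -
  define p where "p t = prob {\<omega> \<in> space M. cmod (\<xi> 0 \<omega>) > exp t}" for t
  have "((\<lambda>t. p t / (1 / t)) \<longlongrightarrow> 0) at_top"
    using smalloD_tendsto[OF tail] by (simp add: p_def)
  moreover have "filterlim (\<lambda>n. \<epsilon> * real n) at_top sequentially"
    using \<epsilon> by (intro filterlim_tendsto_pos_mult_at_top[OF tendsto_const] filterlim_real_sequentially) auto
  ultimately have lim: "(\<lambda>n. p (\<epsilon> * real n) / (1 / (\<epsilon> * real n))) \<longlonglongrightarrow> 0"
    by (rule filterlim_compose)
  have "(\<lambda>n. 2 / \<epsilon> * (p (\<epsilon> * real n) / (1 / (\<epsilon> * real n)))) \<longlonglongrightarrow> 2 / \<epsilon> * 0"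
    by (intro tendsto_mult tendsto_const lim)
  then have lim2: "(\<lambda>n. 2 * real n * p (\<epsilon> * real n)) \<longlonglongrightarrow> 0"
    using \<epsilon> by (simp add: mult_ac)
  have "(\<lambda>n. (real n + 1) * p (\<epsilon> * real n)) \<longlonglongrightarrow> 0"
  proof (rule tendsto_sandwich[OF _ _ tendsto_const lim2])
    show "\<forall>\<^sub>F n in sequentially. 0 \<le> (real n + 1) * p (\<epsilon> * real n)" by (simp add: p_def)
    show "\<forall>\<^sub>F n in sequentially. (real n + 1) * p (\<epsilon> * real n) \<le> 2 * real n * p (\<epsilon> * real n)"
      using eventually_ge_at_top[of 1] by eventually_elim (auto simp: p_def intro!: mult_right_mono)
  qed
  then show ?thesis by (simp only: p_def)
qed

lemma prob_max_xi_lim: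
  assumes \<epsilon>: "\<epsilon> > 0"
  shows "(\<lambda>n. prob {\<omega> \<in> space M. \<exists>i\<le>n. cmod (\<xi> i \<omega>) > exp (\<epsilon> * real n)}) \<longlonglongrightarrow> 0"
proof (rule tendsto_sandwich[OF _ _ tendsto_const tail_lim[OF \<epsilon>]])
  show "\<forall>\<^sub>F n in sequentially. prob {\<omega> \<in> space M. \<exists>i\<le>n. cmod (\<xi> i \<omega>) > exp (\<epsilon> * real n)}
      \<le> (real n + 1) * prob {\<omega> \<in> space M. cmod (\<xi> 0 \<omega>) > exp (\<epsilon> * real n)}"
  proof (intro always_eventually allI)
    fix n
    let ?A = "{z. cmod z > exp (\<epsilon> * real n)}"
    have A: "?A \<in> sets borel" by measurable
    have "prob {\<omega> \<in> space M. \<exists>i\<le>n. cmod (\<xi> i \<omega>) > exp (\<epsilon> * real n)}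
        = prob (\<Union>i\<le>n. {\<omega> \<in> space M. \<xi> i \<omega> \<in> ?A})"
      by (intro arg_cong[where f = prob]) auto
    also have "\<dots> \<le> (\<Sum>i\<le>n. prob {\<omega> \<in> space M. \<xi> i \<omega> \<in> ?A})"
      using A by (intro finite_measure_subadditive_finite) auto
    also have "\<dots> = (\<Sum>i\<le>n. prob {\<omega> \<in> space M. \<xi> 0 \<omega> \<in> ?A})"
      by (intro sum.cong refl prob_xi_eq A)
    finally show "prob {\<omega> \<in> space M. \<exists>i\<le>n. cmod (\<xi> i \<omega>) > exp (\<epsilon> * real n)}
      \<le> (real n + 1) * prob {\<omega> \<in> space M. cmod (\<xi> 0 \<omega>) > exp (\<epsilon> * real n)}"
      by (simp add: algebra_simps)
  qed
qed simp

text \<open>A unit disc with centre of modulus at most \<open>R + 1\<close> misses the set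
  \<open>\<bar>z\<bar> > R + 2\<close>, which has positive probability; any other one lies in
  \<open>\<bar>z\<bar> > R\<close>, whose probability is below 1 once \<open>R\<close> is large.
  Neither bound depends on the centre.\<close>

lemma small_ball:
  obtains \<rho> where "0 \<le> \<rho>" "\<rho> < 1" "\<And>i c. prob {\<omega> \<in> space M. cmod (\<xi> i \<omega> - c) \<le> 1} \<le> \<rho>"
proof -
  have "\<exists>n. (real n + 1) * prob {\<omega> \<in> space M. cmod (\<xi> 0 \<omega>) > exp (1 * real n)} < 1"
    by (rule eventually_happens'[OF sequentially_bot order_tendstoD(2)[OF tail_lim[OF zero_less_one] zero_less_one]])
  then obtain n where n: "(real n + 1) * prob {\<omega> \<in> space M. cmod (\<xi> 0 \<omega>) > exp (1 * real n)} < 1" ..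
  define R where "R = exp (1 * real n)"
  define a where "a = prob {\<omega> \<in> space M. cmod (\<xi> 0 \<omega>) > R}"
  define b where "b = prob {\<omega> \<in> space M. cmod (\<xi> 0 \<omega>) > R + 2}"
  have "a \<le> (real n + 1) * a" by (simp add: a_def algebra_simps)
  then have a: "a < 1" using n unfolding a_def R_def by linarith
  have b: "b > 0" unfolding b_def by (rule xi_unbounded)
  have "prob {\<omega> \<in> space M. cmod (\<xi> i \<omega> - c) \<le> 1} \<le> max a (1 - b)" for i c
  proof -
    have "prob {\<omega> \<in> space M. \<xi> i \<omega> \<in> cball c 1} = prob {\<omega> \<in> space M. \<xi> 0 \<omega> \<in> cball c 1}"
      by (rule prob_xi_eq) simp
    then have "prob {\<omega> \<in> space M. cmod (\<xi> i \<omega> - c) \<le> 1} = prob {\<omega> \<in> space M. cmod (\<xi> 0 \<omega> - c) \<le> 1}"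
      by (simp add: dist_norm norm_minus_commute)
    also have "\<dots> \<le> max a (1 - b)"
    proof (cases "cmod c \<le> R + 1")
      case True
      have "prob {\<omega> \<in> space M. cmod (\<xi> 0 \<omega> - c) \<le> 1} \<le> prob (space M - {\<omega> \<in> space M. cmod (\<xi> 0 \<omega>) > R + 2})"
      proof (rule finite_measure_mono)
        show "{\<omega> \<in> space M. cmod (\<xi> 0 \<omega> - c) \<le> 1} \<subseteq> space M - {\<omega> \<in> space M. cmod (\<xi> 0 \<omega>) > R + 2}"
        proof
          fix \<omega> assume \<omega>: "\<omega> \<in> {\<omega> \<in> space M. cmod (\<xi> 0 \<omega> - c) \<le> 1}"
          then show "\<omega> \<in> space M - {\<omega> \<in> space M. cmod (\<xi> 0 \<omega>) > R + 2}"
            using norm_triangle_ineq[of "\<xi> 0 \<omega> - c" c] True by auto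
        qed
      qed measurable
      also have "\<dots> = 1 - b" unfolding b_def by (rule prob_compl) measurable
      finally show ?thesis by simp
    next
      case False
      have "prob {\<omega> \<in> space M. cmod (\<xi> 0 \<omega> - c) \<le> 1} \<le> a"
        unfolding a_def
      proof (rule finite_measure_mono)
        show "{\<omega> \<in> space M. cmod (\<xi> 0 \<omega> - c) \<le> 1} \<subseteq> {\<omega> \<in> space M. cmod (\<xi> 0 \<omega>) > R}"
        proof
          fix \<omega> assume \<omega>: "\<omega> \<in> {\<omega> \<in> space M. cmod (\<xi> 0 \<omega> - c) \<le> 1}"
          then show "\<omega> \<in> {\<omega> \<in> space M. cmod (\<xi> 0 \<omega>) > R}"
            using norm_triangle_ineq[of "c - \<xi> 0 \<omega>" "\<xi> 0 \<omega>"] False norm_minus_commute[of c "\<xi> 0 \<omega>"]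
            by auto
        qed
      qed measurable
      then show ?thesis by simp
    qed
    finally show ?thesis .
  qed
  note * = this
  show thesis
  proof (rule that)
    show "0 \<le> max a (1 - b)" by (simp add: a_def le_max_iff_disj)
    show "max a (1 - b) < 1" using a b by simp
  qed (rule *)
qed

lemma prob_all_near_le:
  assumes \<rho>: "0 \<le> \<rho>" "\<And>i c. prob {\<omega> \<in> space M. cmod (\<xi> i \<omega> - c) \<le> 1} \<le> \<rho>" and I: "finite I"
  shows "prob {\<omega> \<in> space M. \<forall>i\<in>I. cmod (\<xi> i \<omega> - y i) \<le> 1} \<le> \<rho> ^ card I"
proof (cases "I = {}")
  case True
  then show ?thesis by (simp add: prob_space)
next
  case False
  have eq: "\<xi> i -` cball (y i) 1 \<inter> space M = {\<omega> \<in> space M. cmod (\<xi> i \<omega> - y i) \<le> 1}" for i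
    by (auto simp: dist_norm norm_minus_commute)
  have "prob (\<Inter>i\<in>I. \<xi> i -` cball (y i) 1 \<inter> space M) = (\<Prod>i\<in>I. prob (\<xi> i -` cball (y i) 1 \<inter> space M))"
    using False I by (intro indep_varsD[OF indep]) auto
  also have "\<dots> \<le> (\<Prod>i\<in>I. \<rho>)"
    unfolding eq using \<rho> by (intro prod_mono) auto
  also have "\<dots> = \<rho> ^ card I" by simp
  also have "(\<Inter>i\<in>I. \<xi> i -` cball (y i) 1 \<inter> space M) = {\<omega> \<in> space M. \<forall>i\<in>I. cmod (\<xi> i \<omega> - y i) \<le> 1}"
    unfolding eq using False by auto
  finally show ?thesis .
qed

end

section \<open>Goodness of the random polynomials with high probability\<close>

locale random_orthonormal = heavy_tailed_iid M \<xi> + circle_orthonormal \<tau> q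
  for M :: "'a measure" and \<xi> :: "nat \<Rightarrow> 'a \<Rightarrow> complex"
    and \<tau> :: "complex measure" and q :: "nat \<Rightarrow> complex poly"
begin

abbreviation H :: "nat \<Rightarrow> 'a \<Rightarrow> complex poly" where
  "H n \<omega> \<equiv> random_poly \<xi> q n \<omega>"

lemma coeff_H_measurable [measurable]: "(\<lambda>\<omega>. coeff (H n \<omega>) j) \<in> borel_measurable M"
  unfolding coeff_random_poly by measurable

lemma degree_H: "degree (H n \<omega>) \<le> n"
  unfolding random_poly_def
  by (intro degree_sum_le) (auto intro: order_trans[OF degree_smult_le] simp: q_degree)

text \<open>With \<open>\<xi> i\<close> frozen for \<open>i > J\<close>, two admissible choices of
  the first \<open>J + 1\<close> values differ by coefficients of a combination of
  \<open>q 0, ..., q J\<close> whose own coefficients are at most \<open>2 * \<delta>\<close>.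
  Back-substitution puts these choices within distance 1 of each other. Only
  \<open>q 0, ..., q J\<close> enter, so \<delta> does not depend on \<open>n\<close>.\<close>

lemma low_coeff_prob:
  assumes \<rho>: "0 \<le> \<rho>" "\<And>i c. prob {\<omega> \<in> space M. cmod (\<xi> i \<omega> - c) \<le> 1} \<le> \<rho>"
  shows "\<exists>\<delta>>0. \<forall>n\<ge>J. prob {\<omega> \<in> space M. \<forall>j\<le>J. cmod (coeff (H n \<omega>) j) \<le> \<delta>} \<le> \<rho> ^ Suc J"
proof -
  obtain c0 where c0: "c0 > 0" "\<And>n. c0 * exp (- 1 * real n) \<le> cmod (coeff (q n) n)"
    using q_lead_ge[OF zero_less_one] by blast
  obtain M0 where M0: "M0 > 0" "\<And>n z. cmod z = 1 \<Longrightarrow> cmod (poly (q n) z) \<le> M0 * exp (1 * real n)"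
    using q_circle_le[OF zero_less_one] by blast
  define c where "c = c0 * exp (- real J)"
  define B where "B = M0 * exp (real J)"
  have c: "c > 0" and B: "B > 0" using c0(1) M0(1) by (auto simp: c_def B_def)
  have lc: "c \<le> cmod (coeff (q i) i)" if "i \<le> J" for i
  proof -
    have "c \<le> c0 * exp (- 1 * real i)" unfolding c_def using that c0(1) by simp
    then show ?thesis using c0(2)[of i] by linarith
  qed
  have co: "cmod (coeff (q i) k) \<le> B" if "i \<le> J" for i k
  proof (rule coeff_le_circle)
    fix z :: complex assume "cmod z = 1"
    then have "cmod (poly (q i) z) \<le> M0 * exp (1 * real i)" by (rule M0(2))
    also have "\<dots> \<le> B" unfolding B_def using that M0(1) by simp
    finally show "cmod (poly (q i) z) \<le> B" .
  qed
  \<comment> \<open>Chosen so that back-substitution from \<open>2 * \<delta>\<close> returns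
    exactly 1 after \<open>J\<close> steps.\<close>
  define \<delta> where "\<delta> = c / (2 * (1 + B / c) ^ J)"
  have \<delta>: "\<delta> > 0" unfolding \<delta>_def using c B by (intro divide_pos_pos mult_pos_pos zero_less_power add_pos_pos) auto
  have "prob {\<omega> \<in> space M. \<forall>j\<le>J. cmod (coeff (H n \<omega>) j) \<le> \<delta>} \<le> \<rho> ^ Suc J" if n: "n \<ge> J" for n
  proof -
    define X where "X = (\<lambda>\<omega>. \<lambda>i\<in>{..J}. \<xi> i \<omega>)"
    define Y where "Y = (\<lambda>\<omega>. \<lambda>i\<in>{J<..n}. \<xi> i \<omega>)"
    define N1 where "N1 = PiM {..J} (\<lambda>_. borel :: complex measure)"
    define N2 where "N2 = PiM {J<..n} (\<lambda>_. borel :: complex measure)"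
    define g where "g j p = (\<Sum>i\<le>J. fst p i * coeff (q i) j) + (\<Sum>i\<in>{J<..n}. snd p i * coeff (q i) j)"
      for j and p :: "(nat \<Rightarrow> complex) \<times> (nat \<Rightarrow> complex)"
    define S where "S = {p \<in> space (N1 \<Otimes>\<^sub>M N2). \<forall>j\<in>{..J}. cmod (g j p) \<le> \<delta>}"
    have ind: "indep_var N1 X N2 Y"
      unfolding X_def Y_def N1_def N2_def by (rule indep_var_restrict[OF indep]) auto
    have [measurable]: "X \<in> measurable M N1" "Y \<in> measurable M N2"
      using ind indep_var_rv1 indep_var_rv2 by blast+
    have [measurable]: "(\<lambda>p. fst p i) \<in> borel_measurable (N1 \<Otimes>\<^sub>M N2)" if "i \<in> {..J}" for i
      unfolding N1_def N2_def using that by (intro measurable_compose[OF measurable_fst] measurable_component_singleton)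
    have [measurable]: "(\<lambda>p. snd p i) \<in> borel_measurable (N1 \<Otimes>\<^sub>M N2)" if "i \<in> {J<..n}" for i
      unfolding N1_def N2_def using that by (intro measurable_compose[OF measurable_snd] measurable_component_singleton)
    have g_meas: "g j \<in> borel_measurable (N1 \<Otimes>\<^sub>M N2)" for j
      unfolding g_def by (intro borel_measurable_add borel_measurable_sum borel_measurable_times) auto
    have S: "S \<in> sets (N1 \<Otimes>\<^sub>M N2)"
      unfolding S_def using g_meas by measurable
    have gXY: "g j (X \<omega>, Y \<omega>) = coeff (H n \<omega>) j" for j \<omega>
    proof -
      have "{..n} = {..J} \<union> {J<..n}" using n by auto
      then show ?thesis unfolding coeff_random_poly g_def X_def Y_def
        by (simp add: sum.union_disjoint disjoint_iff)
    qed
    have "{\<omega> \<in> space M. \<forall>j\<le>J. cmod (coeff (H n \<omega>) j) \<le> \<delta>} = {\<omega> \<in> space M. (X \<omega>, Y \<omega>) \<in> S}"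
      using measurable_space[OF \<open>X \<in> measurable M N1\<close>] measurable_space[OF \<open>Y \<in> measurable M N2\<close>]
      by (auto simp: S_def gXY space_pair_measure)
    also have "prob \<dots> \<le> \<rho> ^ Suc J"
    proof (rule prob_indep_var_le[OF ind S])
      fix y assume "y \<in> space N2"
      show "prob {\<omega> \<in> space M. (X \<omega>, y) \<in> S} \<le> \<rho> ^ Suc J"
      proof (cases "\<exists>x. (x, y) \<in> S")
        case True
        then obtain x where x: "(x, y) \<in> S" ..
        have "cmod (\<xi> i \<omega> - x i) \<le> 1" if \<omega>: "(X \<omega>, y) \<in> S" and i: "i \<le> J" for \<omega> i
        proof -
          have "cmod (\<xi> (J - (J - i)) \<omega> - x (J - (J - i))) \<le> (2 * \<delta>) / c * (1 + B / c) ^ (J - i)"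
          proof (rule back_substitution[where q = q and n = J and J = J and d = "\<lambda>i. \<xi> i \<omega> - x i"])
            fix j assume "j \<le> J"
            have "coeff (\<Sum>i\<le>J. smult (\<xi> i \<omega> - x i) (q i)) (J - j) = g (J - j) (X \<omega>, y) - g (J - j) (x, y)"
              by (simp add: coeff_sum g_def X_def sum_subtractf left_diff_distrib)
            also have "cmod \<dots> \<le> \<delta> + \<delta>"
              using \<omega> x by (intro order_trans[OF norm_triangle_ineq4 add_mono]) (auto simp: S_def)
            finally show "cmod (coeff (\<Sum>i\<le>J. smult (\<xi> i \<omega> - x i) (q i)) (J - j)) \<le> 2 * \<delta>" by simp
          qed (use lc co c \<delta> in \<open>auto simp: q_degree\<close>)
          also have "\<dots> \<le> (2 * \<delta>) / c * (1 + B / c) ^ J"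
            using c B \<delta> by (intro mult_left_mono power_increasing) auto
          also have "\<dots> = 1" unfolding \<delta>_def using c B
            by (simp add: field_simps add_pos_pos)
          finally show ?thesis using i by simp
        qed
        then have "prob {\<omega> \<in> space M. (X \<omega>, y) \<in> S} \<le> prob {\<omega> \<in> space M. \<forall>i\<in>{..J}. cmod (\<xi> i \<omega> - x i) \<le> 1}"
          by (intro finite_measure_mono) auto
        also have "\<dots> \<le> \<rho> ^ card {..J}" by (rule prob_all_near_le[OF \<rho>]) auto
        finally show ?thesis by simp
      next
        case False
        then show ?thesis using \<rho> by simp
      qed
    qed (use \<rho> in simp)
    finally show ?thesis .
  qed
  then show ?thesis using \<delta> by blast
qed

text \<open>The top \<open>J + 1\<close> coefficients involve only
  \<open>\<xi> (n - J), ..., \<xi> n\<close>, so the discs are centred at 0. Here the constants of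
  back-substitution depend on \<open>n\<close>, but subexponentially, and the threshold absorbs them
  for large \<open>n\<close>. Its factor \<open>n ^ J\<close> matches the binomials in
  \<open>good\<close>.\<close>

lemma high_coeff_prob:
  assumes \<rho>: "0 \<le> \<rho>" "\<And>i c. prob {\<omega> \<in> space M. cmod (\<xi> i \<omega> - c) \<le> 1} \<le> \<rho>" and \<epsilon>: "\<epsilon> > 0"
  shows "\<forall>\<^sub>F n in sequentially. prob {\<omega> \<in> space M. \<forall>j\<le>J. cmod (coeff (H n \<omega>) (n - j)) \<le> real n ^ J * exp (- \<epsilon> * real n)}
    \<le> \<rho> ^ Suc J"
proof -
  \<comment> \<open>Back-substitution loses \<open>exp ((e + 2 * e * J) * n)\<close>, and this
    choice keeps the exponent at most \<open>\<epsilon> / 2 * n\<close>.\<close>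
  define e where "e = \<epsilon> / (4 * (real J + 1))"
  have e: "e > 0" using \<epsilon> by (simp add: e_def)
  obtain c0 where c0: "c0 > 0" "\<And>n. c0 * exp (- e * real n) \<le> cmod (coeff (q n) n)"
    using q_lead_ge[OF e] by blast
  obtain M0 where M0: "M0 > 0" "\<And>n z. cmod z = 1 \<Longrightarrow> cmod (poly (q n) z) \<le> M0 * exp (e * real n)"
    using q_circle_le[OF e] by blast
  define K where "K = (1 + M0 / c0) ^ J / c0"
  have "(\<lambda>n. K * (real n ^ J * exp (- (\<epsilon> / 2) * real n))) \<longlonglongrightarrow> K * 0"
    using \<epsilon> by (intro tendsto_mult tendsto_const power_times_exp_decay) auto
  then have "\<forall>\<^sub>F n in sequentially. K * (real n ^ J * exp (- (\<epsilon> / 2) * real n)) < 1"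
    by (intro order_tendstoD(2)) auto
  then show ?thesis
    using eventually_ge_at_top[of J]
  proof eventually_elim
    case (elim n)
    define \<delta> where "\<delta> = real n ^ J * exp (- \<epsilon> * real n)"
    define c where "c = c0 * exp (- e * real n)"
    define B where "B = M0 * exp (e * real n)"
    have \<delta>: "\<delta> \<ge> 0" by (simp add: \<delta>_def)
    have c: "c > 0" and B: "B > 0" using c0(1) M0(1) by (auto simp: c_def B_def)
    have lc: "c \<le> cmod (coeff (q i) i)" if "i \<le> n" for i
    proof -
      have "c \<le> c0 * exp (- e * real i)" unfolding c_def using that c0(1) e by simp
      then show ?thesis using c0(2)[of i] by linarith
    qed
    have co: "cmod (coeff (q i) k) \<le> B" if "i \<le> n" for i k
    proof (rule coeff_le_circle)
      fix z :: complex assume "cmod z = 1"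
      then have "cmod (poly (q i) z) \<le> M0 * exp (e * real i)" by (rule M0(2))
      also have "\<dots> \<le> B" unfolding B_def using that M0(1) e by simp
      finally show "cmod (poly (q i) z) \<le> B" .
    qed
    have bound: "\<delta> / c * (1 + B / c) ^ J \<le> 1"
    proof -
      have "1 + B / c \<le> (1 + M0 / c0) * exp (2 * e * real n)"
      proof -
        have "B / c = M0 / c0 * exp (2 * e * real n)"
          by (simp add: B_def c_def exp_minus field_simps flip: exp_add)
        moreover have "1 \<le> exp (2 * e * real n)" using e by simp
        ultimately show ?thesis by (simp add: algebra_simps)
      qed
      then have "\<delta> / c * (1 + B / c) ^ J \<le> \<delta> / c * ((1 + M0 / c0) * exp (2 * e * real n)) ^ J"
        using \<delta> c B by (intro mult_left_mono power_mono) auto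
      also have "\<dots> = K * (real n ^ J * (exp (- \<epsilon> * real n) * exp (e * real n) * exp (2 * e * real n) ^ J))"
        unfolding power_mult_distrib
        by (simp add: K_def \<delta>_def c_def exp_minus divide_inverse mult_ac)
      also have "exp (- \<epsilon> * real n) * exp (e * real n) * exp (2 * e * real n) ^ J
          = exp ((- \<epsilon> + e + 2 * e * real J) * real n)"
        by (simp add: algebra_simps flip: exp_add exp_of_nat_mult)
      also have "K * (real n ^ J * \<dots>) \<le> K * (real n ^ J * exp (- (\<epsilon> / 2) * real n))"
      proof -
        have "e + 2 * e * real J \<le> 2 * (e * (real J + 1))" using e by (simp add: algebra_simps)
        also have "e * (real J + 1) = \<epsilon> / 4" by (simp add: e_def field_simps)
        finally have "- \<epsilon> + e + 2 * e * real J \<le> - (\<epsilon> / 2)" by simp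
        then have "(- \<epsilon> + e + 2 * e * real J) * real n \<le> - (\<epsilon> / 2) * real n" by (rule mult_right_mono) simp
        moreover have "K \<ge> 0" unfolding K_def using M0 c0 by simp
        ultimately show ?thesis by (intro mult_left_mono) auto
      qed
      finally show ?thesis using elim(1) by linarith
    qed
    have "prob {\<omega> \<in> space M. \<forall>j\<le>J. cmod (coeff (H n \<omega>) (n - j)) \<le> \<delta>}
        \<le> prob {\<omega> \<in> space M. \<forall>i\<in>{n - J..n}. cmod (\<xi> i \<omega> - 0) \<le> 1}"
    proof (rule finite_measure_mono)
      show "{\<omega> \<in> space M. \<forall>j\<le>J. cmod (coeff (H n \<omega>) (n - j)) \<le> \<delta>}
        \<subseteq> {\<omega> \<in> space M. \<forall>i\<in>{n - J..n}. cmod (\<xi> i \<omega> - 0) \<le> 1}"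
      proof safe
        fix \<omega> i assume \<omega>: "\<forall>j\<le>J. cmod (coeff (H n \<omega>) (n - j)) \<le> \<delta>" and i: "i \<in> {n - J..n}"
        have "cmod (\<xi> (n - (n - i)) \<omega>) \<le> \<delta> / c * (1 + B / c) ^ (n - i)"
          by (rule back_substitution[where q = q and n = n and J = J and d = "\<lambda>i. \<xi> i \<omega>"])
             (use lc co c \<delta> i \<omega> in \<open>auto simp: q_degree random_poly_def\<close>)
        also have "\<dots> \<le> \<delta> / c * (1 + B / c) ^ J"
          using c B \<delta> i by (intro mult_left_mono power_increasing) auto
        finally show "cmod (\<xi> i \<omega> - 0) \<le> 1" using i bound by simp
      qed
    qed measurable
    also have "\<dots> \<le> \<rho> ^ card {n - J..n}" by (rule prob_all_near_le[OF \<rho>]) auto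
    also have "card {n - J..n} = Suc J" using elim(2) by simp
    finally show ?case unfolding \<delta>_def .
  qed
qed

text \<open>The exponent is split in three: for the \<open>\<xi> i\<close>, for the values of the
  \<open>q i\<close>, and for the constant together with the number of summands.\<close>

lemma circle_bound:
  assumes \<epsilon>: "\<epsilon> > 0"
  shows "\<forall>\<^sub>F n in sequentially. \<forall>\<omega>. (\<forall>i\<le>n. cmod (\<xi> i \<omega>) \<le> exp (\<epsilon> / 3 * real n)) \<longrightarrow>
    (\<forall>z. cmod z = 1 \<longrightarrow> cmod (poly (H n \<omega>) z) \<le> exp (\<epsilon> * real n))"
proof -
  have e: "\<epsilon> / 3 > 0" using \<epsilon> by simp
  obtain M0 where M0: "M0 > 0" "\<And>n z. cmod z = 1 \<Longrightarrow> cmod (poly (q n) z) \<le> M0 * exp (\<epsilon> / 3 * real n)"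
    using q_circle_le[OF e] by blast
  have "(\<lambda>n. 2 * M0 * (real n ^ 1 * exp (- (\<epsilon> / 3) * real n))) \<longlonglongrightarrow> 2 * M0 * 0"
    using e by (intro tendsto_mult tendsto_const power_times_exp_decay) auto
  then have "\<forall>\<^sub>F n in sequentially. 2 * M0 * (real n ^ 1 * exp (- (\<epsilon> / 3) * real n)) < 1"
    by (intro order_tendstoD(2)) auto
  then show ?thesis
    using eventually_ge_at_top[of 1]
  proof eventually_elim
    case (elim n)
    define E where "E = exp (\<epsilon> / 3 * real n)"
    have E: "E > 0" by (simp add: E_def)
    have E3: "E ^ 3 = exp (\<epsilon> * real n)" by (simp add: E_def flip: exp_of_nat_mult)
    have le: "2 * M0 * real n \<le> E"
      using elim(1) E by (simp add: E_def exp_minus field_simps)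
    show ?case
    proof (intro allI impI)
      fix \<omega> z assume \<omega>: "\<forall>i\<le>n. cmod (\<xi> i \<omega>) \<le> exp (\<epsilon> / 3 * real n)" and z: "cmod z = 1"
      have "cmod (poly (H n \<omega>) z) \<le> (\<Sum>i\<le>n. E * (M0 * E))"
        unfolding random_poly_def poly_sum poly_smult
      proof (rule order_trans[OF norm_sum sum_mono])
        fix i assume i: "i \<in> {..n}"
        have "M0 * exp (\<epsilon> / 3 * real i) \<le> M0 * E" unfolding E_def using i e M0(1) by simp
        then have "cmod (poly (q i) z) \<le> M0 * E" using M0(2)[OF z, of i] by linarith
        moreover have "cmod (\<xi> i \<omega>) \<le> E" using \<omega> i by (simp add: E_def)
        ultimately show "cmod (\<xi> i \<omega> * poly (q i) z) \<le> E * (M0 * E)"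
          unfolding norm_mult using E by (intro mult_mono) auto
      qed
      also have "\<dots> = (real n + 1) * M0 * E\<^sup>2" by (simp add: power2_eq_square algebra_simps)
      also have "\<dots> \<le> 2 * M0 * real n * E\<^sup>2"
        using elim(2) M0(1) by (intro mult_right_mono) auto
      also have "\<dots> \<le> E * E\<^sup>2" using le by (intro mult_right_mono) auto
      also have "\<dots> = exp (\<epsilon> * real n)" unfolding E3[symmetric] by (simp add: power2_eq_square power3_eq_cube)
      finally show "cmod (poly (H n \<omega>) z) \<le> exp (\<epsilon> * real n)" .
    qed
  qed
qed

text \<open>Goodness fails only if some \<open>\<xi> i\<close> is huge, or all low coefficients are
  small, or all high ones are; each has probability at most \<open>\<kappa> / 3\<close>. An event
  contained in the good set is asserted, so that measurability of \<open>good\<close> itself is not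
  at issue.\<close>

lemma good_event:
  assumes \<epsilon>: "\<epsilon> > 0" and \<kappa>: "\<kappa> > 0"
  shows "\<forall>\<^sub>F n in sequentially. \<exists>E\<in>events. prob E \<ge> 1 - \<kappa> \<and> (\<forall>\<omega>\<in>E. good n \<epsilon> (H n \<omega>))"
proof -
  obtain \<rho> where \<rho>: "0 \<le> \<rho>" "\<rho> < 1" "\<And>i c. prob {\<omega> \<in> space M. cmod (\<xi> i \<omega> - c) \<le> 1} \<le> \<rho>"
    using small_ball by blast
  obtain J where J: "\<rho> ^ J < \<kappa> / 3"
    using real_arch_pow_inv[of "\<kappa> / 3" \<rho>] \<kappa> \<rho> by auto
  have "\<rho> ^ Suc J \<le> \<rho> ^ J" using \<rho> by (simp add: mult_left_le_one_le)
  then have J: "\<rho> ^ Suc J < \<kappa> / 3" using J by linarith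
  obtain \<delta> where \<delta>: "\<delta> > 0" "\<And>n. n \<ge> J \<Longrightarrow> prob {\<omega> \<in> space M. \<forall>j\<le>J. cmod (coeff (H n \<omega>) j) \<le> \<delta>} \<le> \<rho> ^ Suc J"
    using low_coeff_prob[OF \<rho>(1,3), of J] by blast
  have e: "\<epsilon> / 3 > 0" using \<epsilon> by simp
  have ev1: "\<forall>\<^sub>F n in sequentially. prob {\<omega> \<in> space M. \<exists>i\<le>n. cmod (\<xi> i \<omega>) > exp (\<epsilon> / 3 * real n)} < \<kappa> / 3"
    using \<kappa> by (intro order_tendstoD(2)[OF prob_max_xi_lim[OF e]]) auto
  have ev2: "\<forall>\<^sub>F n in sequentially. real n ^ J * exp (- \<epsilon> * real n) < \<delta>"
    using \<delta>(1) by (intro order_tendstoD(2)[OF power_times_exp_decay[OF \<epsilon>]])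
  have ev3: "\<forall>\<^sub>F n in sequentially. real J \<le> \<epsilon> * real n"
  proof -
    have "filterlim (\<lambda>n. \<epsilon> * real n) at_top sequentially"
      using \<epsilon> by (intro filterlim_tendsto_pos_mult_at_top[OF tendsto_const] filterlim_real_sequentially) auto
    then show ?thesis unfolding filterlim_at_top by blast
  qed
  show ?thesis
    using ev1 ev2 ev3 circle_bound[OF \<epsilon>] high_coeff_prob[OF \<rho>(1,3) \<epsilon>, of J] eventually_ge_at_top[of "max 1 J"]
  proof eventually_elim
    case (elim n)
    have n: "n \<ge> 1" "n \<ge> J" using elim(6) by auto
    define t where "t = real n ^ J * exp (- \<epsilon> * real n)"
    define A1 where "A1 = {\<omega> \<in> space M. \<exists>i\<le>n. cmod (\<xi> i \<omega>) > exp (\<epsilon> / 3 * real n)}"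
    define A2 where "A2 = {\<omega> \<in> space M. \<forall>j\<le>J. cmod (coeff (H n \<omega>) j) \<le> \<delta>}"
    define A3 where "A3 = {\<omega> \<in> space M. \<forall>j\<le>J. cmod (coeff (H n \<omega>) (n - j)) \<le> t}"
    have ev: "A1 \<in> events" "A2 \<in> events" "A3 \<in> events"
      unfolding A1_def A2_def A3_def by measurable
    have "prob (A1 \<union> A2 \<union> A3) \<le> prob A1 + prob A2 + prob A3"
      using measure_Un_le[of "A1 \<union> A2" M A3] measure_Un_le[of A1 M A2] ev by fastforce
    also have "\<dots> \<le> \<kappa>"
      using elim(1) \<delta>(2)[OF n(2)] elim(5) J unfolding A1_def A2_def A3_def t_def by linarith
    finally have "prob (space M - (A1 \<union> A2 \<union> A3)) \<ge> 1 - \<kappa>"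
      using ev by (subst prob_compl) auto
    moreover have "space M - (A1 \<union> A2 \<union> A3) \<in> events" using ev by auto
    moreover have "good n \<epsilon> (H n \<omega>)" if \<omega>: "\<omega> \<in> space M - (A1 \<union> A2 \<union> A3)" for \<omega>
    proof -
      \<comment> \<open>\<open>n ^ J\<close> dominates all binomials \<open>n choose j\<close> with
        \<open>j \<le> J\<close>, so the threshold \<open>t\<close> works for whichever coefficient
        is large.\<close>
      have bin: "real (n choose j) * exp (- \<epsilon> * real n) \<le> t" if "j \<le> J" for j
      proof -
        have "n choose j \<le> n ^ j" using that n by (intro binomial_le_pow) auto
        also have "\<dots> \<le> n ^ J" using that n by (intro power_increasing) auto
        finally have "real (n choose j) \<le> real n ^ J" by (metis of_nat_le_iff of_nat_power)
        then show ?thesis unfolding t_def by (intro mult_right_mono) auto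
      qed
      have jJ: "j \<le> n \<and> real j \<le> \<epsilon> * real n" if "j \<le> J" for j using that n elim(3) by linarith
      obtain j where j: "j \<le> J" "cmod (coeff (H n \<omega>) j) > \<delta>"
        using \<omega> by (auto simp: A2_def not_le)
      obtain k where k: "k \<le> J" "cmod (coeff (H n \<omega>) (n - k)) > t"
        using \<omega> by (auto simp: A3_def not_le)
      have "\<forall>i\<le>n. cmod (\<xi> i \<omega>) \<le> exp (\<epsilon> / 3 * real n)"
        using \<omega> by (auto simp: A1_def not_less)
      then have "\<forall>z. cmod z = 1 \<longrightarrow> cmod (poly (H n \<omega>) z) \<le> exp (\<epsilon> * real n)"
        using elim(4) by blast
      moreover have "real (n choose j) * exp (- \<epsilon> * real n) \<le> cmod (coeff (H n \<omega>) j)"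
        using bin[OF j(1)] j(2) elim(2) unfolding t_def by linarith
      moreover have "real (n choose k) * exp (- \<epsilon> * real n) \<le> cmod (coeff (H n \<omega>) (n - k))"
        using bin[OF k(1)] k(2) by linarith
      ultimately show ?thesis
        unfolding good_def using degree_H jJ[OF j(1)] jJ[OF k(1)] by blast
    qed
    ultimately show ?case by blast
  qed
qed

end

section \<open>Measurability and conclusion\<close>

text \<open>Convergence of integrals concerns subbasic sets; the induction on the generation of
  \<open>U\<close> carries it to all open sets.\<close>

lemma eventually_in_weak_star:
  fixes \<mu> :: "nat \<Rightarrow> complex measure"
  assumes lim: "\<And>f :: complex \<Rightarrow> real. continuous_on UNIV f \<Longrightarrow> bounded (range f) \<Longrightarrow>
      (\<lambda>k. \<integral>z. f z \<partial>\<mu> k) \<longlonglongrightarrow> (\<integral>z. f z \<partial>\<nu>)"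
    and top: "\<And>k. \<mu> k \<in> topspace weak_star"
    and U: "openin weak_star U" "\<nu> \<in> U"
  shows "\<forall>\<^sub>F k in sequentially. \<mu> k \<in> U"
proof -
  have "generate_topology_on
     {{\<mu> \<in> space (subprob_algebra borel). (\<integral>z. f z \<partial>\<mu>) \<in> V} | (f :: complex \<Rightarrow> real) V.
        continuous_on UNIV f \<and> bounded (range f) \<and> open V} U"
    using U(1) unfolding weak_star_def by (rule openin_topology_generated_by)
  then show ?thesis using U(2)
  proof induction
    case (Int a b)
    then show ?case by (auto intro: eventually_conj)
  next
    case (UN K)
    then obtain k where k: "k \<in> K" "\<nu> \<in> k" by blast
    show ?case using UN.IH[OF k] by eventually_elim (use k in blast)
  next
    case (Basis s)
    then obtain f :: "complex \<Rightarrow> real" and V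
      where s: "s = {\<mu> \<in> space (subprob_algebra borel). (\<integral>z. f z \<partial>\<mu>) \<in> V}"
        and f: "continuous_on UNIV f" "bounded (range f)" and V: "open V" by blast
    have "\<forall>\<^sub>F k in sequentially. (\<integral>z. f z \<partial>\<mu> k) \<in> V"
      using Basis.prems s by (intro topological_tendstoD[OF lim[OF f] V]) auto
    then show ?case unfolding s using top by (simp add: topspace_weak_star)
  qed auto
qed

section \<open>Continuity of the roots and measurability\<close>

lemma convergent_subsequence_finite:
  fixes z :: "nat \<Rightarrow> nat \<Rightarrow> complex"
  assumes "\<And>k i. i < d \<Longrightarrow> cmod (z k i) \<le> R"
  shows "\<exists>r l. strict_mono r \<and> (\<forall>i<d. (\<lambda>k. z (r k) i) \<longlonglongrightarrow> l i)"
  using assms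
proof (induction d)
  case 0
  show ?case by (intro exI[of _ id]) (auto simp: strict_mono_def)
next
  case (Suc d)
  then obtain r l where r: "strict_mono r" "\<And>i. i < d \<Longrightarrow> (\<lambda>k. z (r k) i) \<longlonglongrightarrow> l i"
    by (metis less_SucI)
  have "bounded (range (\<lambda>k. z (r k) d))"
    using Suc.prems[of d] unfolding bounded_iff by blast
  then obtain m s where s: "strict_mono s" "((\<lambda>k. z (r k) d) \<circ> s) \<longlonglongrightarrow> m"
    using bounded_imp_convergent_subsequence by blast
  have "(\<lambda>k. z (r (s k)) i) \<longlonglongrightarrow> (l(d := m)) i" if "i < Suc d" for i
  proof (cases "i = d")
    case True
    then show ?thesis using s(2) by (simp add: o_def)
  next
    case False
    then have "(\<lambda>k. z (r k) i) \<longlonglongrightarrow> l i" using that by (intro r(2)) auto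
    from LIMSEQ_subseq_LIMSEQ[OF this s(1)] show ?thesis using False by (simp add: o_def)
  qed
  moreover have "strict_mono (\<lambda>k. r (s k))"
    using strict_mono_o[OF r(1) s(1)] by (simp add: o_def)
  ultimately show ?case by blast
qed

text \<open>All other factors of the Mahler measure are at least 1, so it dominates the leading
  coefficient times any single root.\<close>

lemma proots_norm_le:
  assumes p: "p \<noteq> 0" and B: "\<And>z. cmod z = 1 \<Longrightarrow> cmod (poly p z) \<le> B" and x: "x \<in># proots p"
  shows "cmod x \<le> B / cmod (lead_coeff p)"
proof -
  have one: "1 \<le> (\<Prod>x\<in>#N. max 1 (cmod x))" for N :: "complex multiset"
  proof (induction N)
    case (add y N)
    then show ?case using mult_mono[of 1 "max 1 (cmod y)" 1 "\<Prod>x\<in>#N. max 1 (cmod x)"] by simp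
  qed simp
  obtain N where N: "proots p = add_mset x N" using x by (metis multi_member_split)
  have "cmod x * 1 \<le> max 1 (cmod x) * (\<Prod>x\<in>#N. max 1 (cmod x))"
    by (intro mult_mono one) auto
  then have "cmod (lead_coeff p) * cmod x \<le> mahler p"
    unfolding mahler_def N by (simp add: mult_left_mono)
  then have "cmod (lead_coeff p) * cmod x \<le> B" using mahler_le[OF B] by linarith
  then show ?thesis using p by (simp add: field_simps)
qed

text \<open>The roots stay bounded because the leading coefficients tend to a nonzero limit. Along a
  subsequence an arbitrary enumeration of them converges, and passing to the limit in the
  factorisation identifies the limits, with multiplicity, as the roots of \<open>p'\<close>.\<close>

lemma sum_proots_subseq_tendsto:
  fixes p :: "nat \<Rightarrow> complex poly"
  assumes deg: "\<And>k. degree (p k) = d" "degree p' = d" and p': "p' \<noteq> 0" and pk: "\<And>k. p k \<noteq> 0"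
    and lim: "\<And>i. (\<lambda>k. coeff (p k) i) \<longlonglongrightarrow> coeff p' i"
  shows "\<exists>r. strict_mono r \<and> (\<forall>f :: complex \<Rightarrow> real. continuous_on UNIV f \<longrightarrow>
     (\<lambda>k. \<Sum>x\<in>#proots (p (r k)). f x) \<longlonglongrightarrow> (\<Sum>x\<in>#proots p'. f x))"
proof -
  have limz: "(\<lambda>k. poly (p k) z) \<longlonglongrightarrow> poly p' z" for z
    unfolding poly_altdef deg by (intro tendsto_sum tendsto_mult lim tendsto_const)
  have lc': "coeff p' d \<noteq> 0" using p' deg by (metis leading_coeff_0_iff)
  have lck: "coeff (p k) d \<noteq> 0" for k using pk deg by (metis leading_coeff_0_iff)
  have "(\<lambda>k. (\<Sum>i\<le>d. cmod (coeff (p k) i)) / cmod (coeff (p k) d)) \<longlonglongrightarrow> (\<Sum>i\<le>d. cmod (coeff p' i)) / cmod (coeff p' d)"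
    using lc' by (intro tendsto_divide tendsto_sum tendsto_norm lim) auto
  then have "Bseq (\<lambda>k. (\<Sum>i\<le>d. cmod (coeff (p k) i)) / cmod (coeff (p k) d))"
    by (intro convergent_imp_Bseq convergentI)
  then obtain R where R: "\<And>k. norm ((\<Sum>i\<le>d. cmod (coeff (p k) i)) / cmod (coeff (p k) d)) \<le> R"
    unfolding Bseq_def by blast
  have roots: "cmod x \<le> R" if "x \<in># proots (p k)" for x k
  proof -
    have "cmod (poly (p k) z) \<le> (\<Sum>i\<le>d. cmod (coeff (p k) i))" if "cmod z = 1" for z
      unfolding poly_altdef deg using that by (intro order_trans[OF norm_sum sum_mono]) (simp add: norm_mult norm_power)
    from proots_norm_le[OF pk this \<open>x \<in># proots (p k)\<close>]
    show ?thesis using order_trans[OF abs_ge_self R[of k, unfolded real_norm_def]] unfolding deg by linarith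
  qed
  have "\<forall>k. \<exists>xs. proots (p k) = mset xs" by (metis ex_mset)
  then obtain xs where xs: "\<And>k. proots (p k) = mset (xs k)" by metis
  have len: "length (xs k) = d" for k
    using size_proots_complex[of "p k"] deg by (simp add: xs)
  have sum_xs: "(\<Sum>x\<in>#proots (p k). f x) = (\<Sum>i<d. f (xs k ! i))" for f :: "complex \<Rightarrow> real" and k
    by (simp add: xs len sum_mset_sum_list sum_list_sum_nth atLeast0LessThan flip: mset_map)
  have prod_xs: "(\<Prod>x\<in>#proots (p k). f x) = (\<Prod>i<d. f (xs k ! i))" for f :: "complex \<Rightarrow> complex" and k
    by (simp add: xs len prod_mset_prod_list prod.list_conv_set_nth atLeast0LessThan flip: mset_map)
  have "cmod (xs k ! i) \<le> R" if "i < d" for k i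
    using that len by (intro roots[of _ k]) (simp add: xs)
  from convergent_subsequence_finite[of d "\<lambda>k i. xs k ! i", OF this]
  obtain r l where r: "strict_mono r" and l: "\<And>i. i < d \<Longrightarrow> (\<lambda>k. xs (r k) ! i) \<longlonglongrightarrow> l i"
    by blast
  have "poly p' z = poly (smult (coeff p' d) (\<Prod>i<d. [:- l i, 1:])) z" for z
  proof (rule LIMSEQ_unique)
    show "(\<lambda>k. poly (p (r k)) z) \<longlonglongrightarrow> poly p' z"
      using LIMSEQ_subseq_LIMSEQ[OF limz r] by (simp add: o_def)
    have "(\<lambda>k. coeff (p (r k)) d * (\<Prod>i<d. z - xs (r k) ! i)) \<longlonglongrightarrow> coeff p' d * (\<Prod>i<d. z - l i)"
    proof (intro tendsto_mult tendsto_prod tendsto_diff tendsto_const)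
      show "(\<lambda>k. coeff (p (r k)) d) \<longlonglongrightarrow> coeff p' d"
        using LIMSEQ_subseq_LIMSEQ[OF lim r] by (simp add: o_def)
    qed (use l in auto)
    moreover have "poly (p k) z = coeff (p k) d * (\<Prod>i<d. z - xs k ! i)" for k
      by (subst poly_eq_prod_proots) (simp add: prod_xs deg)
    ultimately show "(\<lambda>k. poly (p (r k)) z) \<longlonglongrightarrow> poly (smult (coeff p' d) (\<Prod>i<d. [:- l i, 1:])) z"
      by (simp add: poly_prod)
  qed
  then have "p' = smult (coeff p' d) (\<Prod>i<d. [:- l i, 1:])"
    using poly_eq_poly_eq_iff by blast
  then have "proots p' = proots (smult (coeff p' d) (\<Prod>i<d. [:- l i, 1:]))" by simp
  also have "\<dots> = proots (\<Prod>i<d. [:- l i, 1:])" using lc' by (rule proots_smult)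
  also have "\<dots> = (\<Sum>i<d. proots [:- l i, 1:])" by (rule proots_prod) auto
  also have "\<dots> = (\<Sum>i<d. {#l i#})" by simp
  finally have pr: "proots p' = (\<Sum>i<d. {#l i#})" .
  have sum_l: "(\<Sum>x\<in>#(\<Sum>i<d. {#l i#}). f x) = (\<Sum>i<d. f (l i))" for f :: "complex \<Rightarrow> real"
    by (induction d) (auto simp: add.commute)
  have "(\<lambda>k. \<Sum>x\<in>#proots (p (r k)). f x) \<longlonglongrightarrow> (\<Sum>x\<in>#proots p'. f x)"
    if f: "continuous_on UNIV f" for f :: "complex \<Rightarrow> real"
    unfolding sum_xs pr sum_l
    by (intro tendsto_sum continuous_on_tendsto_compose[OF f l]) auto
  then show ?thesis using r by blast
qed

text \<open>
  The roots depend continuously on the coefficients once the degree is fixed, so on each set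
  \<open>D d\<close> of constant degree the condition is relatively open.
\<close>

lemma zero_counting_in_open_measurable:
  fixes q :: "nat \<Rightarrow> complex poly"
  assumes U: "openin weak_star U" and q: "\<And>i. i \<le> n \<Longrightarrow> degree (q i) \<le> n"
  shows "{x :: nat \<Rightarrow> complex. zero_counting n (\<Sum>i\<le>n. smult (x i) (q i)) \<in> U} \<in> sets borel"
proof -
  define P where "P x = (\<Sum>i\<le>n. smult (x i) (q i))" for x :: "nat \<Rightarrow> complex"
  define D where "D d = {x. degree (P x) = d \<and> P x \<noteq> 0}" for d
  define A where "A = {x. zero_counting n (P x) \<in> U}"
  have degP: "degree (P x) \<le> n" for x
    unfolding P_def using q by (intro degree_sum_le) (auto intro: order_trans[OF degree_smult_le])
  have coeffP: "continuous_on UNIV (\<lambda>x. coeff (P x) i)" for i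
    unfolding P_def coeff_sum coeff_smult
    by (intro continuous_on_sum continuous_on_mult continuous_on_const continuous_on_product_coordinates)
  have meas [measurable]: "(\<lambda>x. coeff (P x) i) \<in> borel_measurable borel" for i
    by (rule borel_measurable_continuous_onI[OF coeffP])
  \<comment> \<open>Degrees are at most \<open>n\<close>, so finitely many coefficient conditions
    describe the set.\<close>
  have D_eq: "D d = {x \<in> space borel. coeff (P x) d \<noteq> 0 \<and> (\<forall>i\<in>{d<..n}. coeff (P x) i = 0)}" for d
  proof safe
    fix x assume "x \<in> D d"
    then have *: "degree (P x) = d" "P x \<noteq> 0" by (auto simp: D_def)
    then show "coeff (P x) d = 0 \<Longrightarrow> False" by auto
    show "coeff (P x) i = 0" if "i \<in> {d<..n}" for i using * that by (auto intro: coeff_eq_0)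
  next
    fix x assume *: "coeff (P x) d \<noteq> 0" "\<forall>i\<in>{d<..n}. coeff (P x) i = 0"
    have "degree (P x) \<le> d"
    proof (rule degree_le, intro allI impI)
      fix i assume "d < i"
      then show "coeff (P x) i = 0" using * degP[of x] by (cases "i \<le> n") (auto intro: coeff_eq_0)
    qed
    moreover have "d \<le> degree (P x)" using * by (intro le_degree)
    ultimately show "x \<in> D d" using * by (auto simp: D_def)
  qed simp
  have D_meas: "D d \<in> sets borel" for d unfolding D_eq by measurable
  have Z_meas: "{x. P x = 0} \<in> sets borel"
  proof -
    have "{x. P x = 0} = {x \<in> space borel. \<forall>i\<in>{..n}. coeff (P x) i = 0}"
    proof safe
      fix x assume *: "\<forall>i\<in>{..n}. coeff (P x) i = 0"
      then have "coeff (P x) i = 0" for i using degP[of x] by (cases "i \<le> n") (auto intro: coeff_eq_0)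
      then show "P x = 0" by (simp add: poly_eq_iff)
    qed auto
    then show ?thesis by simp
  qed
  have AD: "A \<inter> D d = D d - closure (D d - A)" for d
  proof (intro equalityI subsetI)
    fix x assume x: "x \<in> A \<inter> D d"
    have "x \<notin> closure (D d - A)"
    proof
      assume "x \<in> closure (D d - A)"
      then obtain y where y: "\<And>k. y k \<in> D d - A" "y \<longlonglongrightarrow> x" unfolding closure_sequential by blast
      have "(\<lambda>k. coeff (P (y k)) i) \<longlonglongrightarrow> coeff (P x) i" for i
        by (rule continuous_on_tendsto_compose[OF coeffP y(2)]) auto
      then obtain r where r: "strict_mono r" "\<And>f :: complex \<Rightarrow> real. continuous_on UNIV f \<Longrightarrow>
         (\<lambda>k. \<Sum>x\<in>#proots (P (y (r k))). f x) \<longlonglongrightarrow> (\<Sum>x\<in>#proots (P x). f x)"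
        using sum_proots_subseq_tendsto[of "\<lambda>k. P (y k)" d "P x"] y(1) x unfolding D_def by blast
      have "\<forall>\<^sub>F k in sequentially. zero_counting n (P (y (r k))) \<in> U"
      proof (rule eventually_in_weak_star[OF _ _ U])
        fix f :: "complex \<Rightarrow> real" assume f: "continuous_on UNIV f"
        have "integral\<^sup>L (zero_counting n p) f = (\<Sum>x\<in>#proots p. f x) / real n" for p
          using integral_zero_counting[OF borel_measurable_continuous_onI[OF f]] .
        then show "(\<lambda>k. \<integral>z. f z \<partial>zero_counting n (P (y (r k)))) \<longlonglongrightarrow> (\<integral>z. f z \<partial>zero_counting n (P x))"
          using r(2)[OF f] by (simp add: divide_inverse tendsto_mult_right)
      next
        show "zero_counting n (P (y (r k))) \<in> topspace weak_star" for k
          by (intro zero_counting_in_topspace degP)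
        show "zero_counting n (P x) \<in> U" using x by (simp add: A_def)
      qed
      then obtain k where "zero_counting n (P (y (r k))) \<in> U"
        using eventually_happens'[OF sequentially_bot] by blast
      then show False using y(1)[of "r k"] by (simp add: A_def)
    qed
    then show "x \<in> D d - closure (D d - A)" using x by blast
  next
    fix x assume "x \<in> D d - closure (D d - A)"
    then show "x \<in> A \<inter> D d" using closure_subset[of "D d - A"] by blast
  qed
  have "A = (\<Union>d\<le>n. A \<inter> D d) \<union> (A \<inter> {x. P x = 0})"
    using degP by (auto simp: D_def)
  moreover have "A \<inter> D d \<in> sets borel" for d
    unfolding AD by (intro sets.Diff D_meas borel_closed closed_closure)
  \<comment> \<open>On the zero polynomial the measure is constant, so this piece is all or
    nothing.\<close>
  moreover have "A \<inter> {x. P x = 0} = (if zero_counting n 0 \<in> U then {x. P x = 0} else {})"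
    by (auto simp: A_def)
  then have "A \<inter> {x. P x = 0} \<in> sets borel" using Z_meas by simp
  ultimately have "A \<in> sets borel" by (metis (no_types, lifting) sets.Un sets.finite_UN finite_atMost)
  then show ?thesis by (simp add: A_def P_def)
qed

section \<open>Convergence in probability and almost surely along subsequences\<close>

context random_orthonormal
begin

text \<open>\<open>measure\<close> is 0 on nonmeasurable sets, so a lower bound on this probability
  requires measurability first.\<close>

lemma zero_counting_event:
  assumes "openin weak_star U"
  shows "{\<omega> \<in> space M. zero_counting n (H n \<omega>) \<in> U} \<in> events"
proof -
  define S where "S = {x :: nat \<Rightarrow> complex. zero_counting n (\<Sum>i\<le>n. smult (x i) (q i)) \<in> U}"
  have "S \<in> sets borel"
    unfolding S_def using assms by (rule zero_counting_in_open_measurable) (simp add: q_degree)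
  moreover have "(\<lambda>\<omega> i. \<xi> i \<omega>) \<in> measurable M (PiM UNIV (\<lambda>_. borel))"
    by (rule measurable_PiM_single') auto
  \<comment> \<open>For countably many coordinates the product sigma-algebra is the Borel
    sigma-algebra of the product topology.\<close>
  then have "(\<lambda>\<omega> i. \<xi> i \<omega>) \<in> measurable M borel"
    using measurable_cong_sets[OF refl sets_PiM_equal_borel] by blast
  ultimately have "(\<lambda>\<omega> i. \<xi> i \<omega>) -` S \<inter> space M \<in> events" by (rule measurable_sets[rotated])
  also have "(\<lambda>\<omega> i. \<xi> i \<omega>) -` S \<inter> space M = {\<omega> \<in> space M. zero_counting n (H n \<omega>) \<in> U}"
    by (auto simp: S_def random_poly_def)
  finally show ?thesis .
qed

lemma zero_counting_in_probability:
  "converges_in_probability M weak_star (\<lambda>n \<omega>. zero_counting n (H n \<omega>)) uniform_circle"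
  unfolding converges_in_probability_def
proof (intro allI impI, elim conjE)
  fix U assume U: "openin weak_star U" "uniform_circle \<in> U"
  obtain \<epsilon> where \<epsilon>: "\<epsilon> > 0" "\<And>n p. n \<ge> 1 \<Longrightarrow> good n \<epsilon> p \<Longrightarrow> zero_counting n p \<in> U"
    using good_imp_near_uniform_circle[OF U] by blast
  show "(\<lambda>n. prob {\<omega> \<in> space M. zero_counting n (H n \<omega>) \<in> U}) \<longlonglongrightarrow> 1"
  proof (rule tendstoI)
    fix \<kappa> :: real assume "\<kappa> > 0"
    then have "\<kappa> / 2 > 0" by simp
    from good_event[OF \<epsilon>(1) this] eventually_ge_at_top[of 1]
    show "\<forall>\<^sub>F n in sequentially. dist (prob {\<omega> \<in> space M. zero_counting n (H n \<omega>) \<in> U}) 1 < \<kappa>"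
    proof eventually_elim
      case (elim n)
      then obtain E where E: "E \<in> events" "prob E \<ge> 1 - \<kappa> / 2" "\<And>\<omega>. \<omega> \<in> E \<Longrightarrow> good n \<epsilon> (H n \<omega>)" by blast
      have "prob E \<le> prob {\<omega> \<in> space M. zero_counting n (H n \<omega>) \<in> U}"
        using E sets.sets_into_space[OF E(1)] \<epsilon>(2) elim(2)
        by (intro finite_measure_mono zero_counting_event U) auto
      moreover have "prob {\<omega> \<in> space M. zero_counting n (H n \<omega>) \<in> U} \<le> 1" by simp
      ultimately show ?case using E(2) \<open>\<kappa> > 0\<close> by (simp add: dist_real_def)
    qed
  qed
qed

text \<open>Borel-Cantelli for goodness with parameters \<open>2 ^ (- k)\<close>. Since goodness
  does not refer to a neighbourhood, a single null set serves all open \<open>U\<close> at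
  once.\<close>

lemma zero_counting_subseq_AE:
  fixes r :: "nat \<Rightarrow> nat"
  assumes r: "strict_mono r"
  shows "\<exists>s. strict_mono s \<and> (AE \<omega> in M. limitin weak_star
      (\<lambda>k. zero_counting (r (s k)) (H (r (s k)) \<omega>)) uniform_circle sequentially)"
proof -
  define e where "e k = (1 / 2 :: real) ^ k" for k :: nat
  have e: "e k > 0" for k by (simp add: e_def)
  have "\<forall>k. \<exists>N. \<forall>n\<ge>N. \<exists>E\<in>events. prob E \<ge> 1 - e k \<and> (\<forall>\<omega>\<in>E. good n (e k) (H n \<omega>))"
    using good_event[OF e e] unfolding eventually_sequentially by blast
  then obtain N where N: "\<And>k n. n \<ge> N k \<Longrightarrow> \<exists>E\<in>events. prob E \<ge> 1 - e k \<and> (\<forall>\<omega>\<in>E. good n (e k) (H n \<omega>))"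
    by metis
  \<comment> \<open>Cumulative sums make \<open>s\<close> strictly increasing, at least 1 and at
    least \<open>N k\<close>; since \<open>r (s k) \<ge> s k\<close>, the same holds for the lower
    bounds on \<open>t k\<close>.\<close>
  define s where "s k = (\<Sum>i\<le>k. Suc (N i))" for k
  have s: "strict_mono s" by (rule strict_mono_Suc_iff[THEN iffD2]) (simp add: s_def)
  have sN: "N k \<le> s k" "1 \<le> s k" for k
    unfolding s_def using member_le_sum[of k "{..k}" "\<lambda>i. Suc (N i)"] by auto
  define t where "t k = r (s k)" for k
  have rge: "s k \<le> t k" for k unfolding t_def using strict_mono_imp_increasing[OF r] .
  have "\<forall>k. \<exists>E\<in>events. prob E \<ge> 1 - e k \<and> (\<forall>\<omega>\<in>E. good (t k) (e k) (H (t k) \<omega>))"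
    using N rge sN by (meson order_trans)
  then obtain E where E: "\<And>k. E k \<in> events" "\<And>k. prob (E k) \<ge> 1 - e k"
    "\<And>k \<omega>. \<omega> \<in> E k \<Longrightarrow> good (t k) (e k) (H (t k) \<omega>)" by metis
  have "AE \<omega> in M. \<forall>\<^sub>F k in sequentially. \<omega> \<in> space M - (space M - E k)"
  proof (rule borel_cantelli_AE1)
    show "summable (\<lambda>k. prob (space M - E k))"
    proof (rule summable_comparison_test')
      show "summable e" unfolding e_def by (rule summable_geometric) simp
      show "norm (prob (space M - E k)) \<le> e k" if "k \<ge> 0" for k
        using E(1,2)[of k] by (simp add: prob_compl)
    qed
  qed (use E(1) in \<open>auto simp: emeasure_eq_measure\<close>)
  then have "AE \<omega> in M. limitin weak_star (\<lambda>k. zero_counting (t k) (H (t k) \<omega>)) uniform_circle sequentially"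
  proof eventually_elim
    case (elim \<omega>)
    show ?case unfolding limitin_def
    proof (intro conjI uniform_circle_in_topspace allI impI, elim conjE)
      fix U assume U: "openin weak_star U" "uniform_circle \<in> U"
      obtain \<epsilon> where \<epsilon>: "\<epsilon> > 0" "\<And>n p. n \<ge> 1 \<Longrightarrow> good n \<epsilon> p \<Longrightarrow> zero_counting n p \<in> U"
        using good_imp_near_uniform_circle[OF U] by blast
      have "e \<longlonglongrightarrow> 0" unfolding e_def by (rule LIMSEQ_power_zero) simp
      then have "\<forall>\<^sub>F k in sequentially. e k < \<epsilon>" using \<epsilon>(1) by (rule order_tendstoD(2))
      with elim show "\<forall>\<^sub>F k in sequentially. zero_counting (t k) (H (t k) \<omega>) \<in> U"
      proof eventually_elim
        case (elim k)
        then have "good (t k) \<epsilon> (H (t k) \<omega>)" using E(3)[of \<omega> k] by (auto intro: good_mono less_imp_le)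
        moreover have "t k \<ge> 1" using rge[of k] sN[of k] by linarith
        ultimately show ?case using \<epsilon>(2) by blast
      qed
    qed
  qed
  then show ?thesis using s unfolding t_def by blast
qed

end

theorem mainTheorem6:
  fixes M :: "'a measure" and \<xi> :: "nat \<Rightarrow> 'a \<Rightarrow> complex"
    and \<tau> :: "complex measure" and q :: "nat \<Rightarrow> complex poly"
  assumes "prob_space M"
    and "prob_space.indep_vars M (\<lambda>_. borel) \<xi> UNIV"
    and "\<And>i. distr M borel (\<xi> i) = distr M borel (\<xi> 0)"
    and "(\<integral>\<^sup>+ \<omega>. ennreal (ln (1 + cmod (\<xi> 0 \<omega>))) \<partial>M) = \<infinity>"
    and "(\<lambda>t. measure M {\<omega> \<in> space M. cmod (\<xi> 0 \<omega>) > exp t}) \<in> o[at_top](\<lambda>t::real. 1 / t)"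
    and "finite_measure_on (sphere 0 1) \<tau>"
    and "bernstein_markov (sphere 0 1) \<tau>"
    and "gram_schmidt_monomials \<tau> q"
  shows "converges_in_probability M weak_star
           (\<lambda>n \<omega>. zero_counting n (random_poly \<xi> q n \<omega>)) uniform_circle
       \<and> (\<forall>r :: nat \<Rightarrow> nat. strict_mono r \<and> (\<forall>i. r i \<ge> 1) \<longrightarrow>
            (\<exists>s :: nat \<Rightarrow> nat. strict_mono s \<and>
              (AE \<omega> in M. limitin weak_star
                 (\<lambda>k. zero_counting (r (s k)) (random_poly \<xi> q (r (s k)) \<omega>))
                 uniform_circle sequentially)))"
proof -
  interpret prob_space M by fact
  interpret random_orthonormal M \<xi> \<tau> q
    by unfold_locales (fact assms)+
  show ?thesis using zero_counting_in_probability zero_counting_subseq_AE by blast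
qed

end
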